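(* Let $n\ge 1$ be an integer with $n\neq 3$, and assume that the Gasca–Maeztu conjecture holds for all degrees up to $n$, i.e. for every $1\le k\le n$ every $GC_k$ set possesses a maximal line. Let $\mathcal X$ be a $GC_n$ set and let $\ell$ be an $n$-node line of $\mathcal X$. Then $$|\mathcal X_\ell|=\binom{n}{2}\quad\text{or}\quad |\mathcal X_\ell|=\binom{n-1}{2}.$$ Moreover, the following hold: (i) $|\mathcal X_\ell|=\binom n2$ if and only if there is a maximal line $M_0$ of $\mathcal X$ such that $M_0\cap\ell\cap\mathcal X=\emptyset$. In this case $\mathcal X_\ell=\mathcal X\setminus(\ell\cup M_0)$; hence $\mathcal X_\ell$ is a $GC_{n-2}$ set. (ii) $|\mathcal X_\ell|=\binom{n-1}{2}$ if and only if there are two distinct maximal lines $M',M''$ of $\mathcal X$ such that the point $M'\cap M''$ lies on $\ell$ and belongs to $\mathcal X$ (written $M'\cap M''\cap\ell\in\mathcal X$). In this case $\mathcal X_\ell=\mathcal X\setminus(\ell\cup M'\cup M'')$; hence $\mathcal X_\ell$ is a $GC_{n-3}$ set.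
   Context: $\Pi_n$ denotes the space of real bivariate polynomials of total degree at most $n$; $\dim\Pi_n=\binom{n+2}{2}$. A finite set $\mathcal X$ of distinct points (nodes) in the plane is $n$-poised if for arbitrary prescribed values at the nodes there is a unique $p\in\Pi_n$ taking these values; then $|\mathcal X|=\binom{n+2}{2}$. For an $n$-poised set $\mathcal X$ and $A\in\mathcal X$, the ($n$-)fundamental polynomial $p_A^\star\in\Pi_n$ is the one equal to $1$ at $A$ and $0$ at all other nodes. An $n$-poised set is a $GC_n$ set if the fundamental polynomial of each of its nodes is a product of $n$ linear factors (polynomials of degree one). A line is identified with a degree-one polynomial defining it. A node $A\in\mathcal X$ uses a line $\ell$ if $p_A^\star=\ell q$ for some $q\in\Pi_{n-1}$. A $k$-node line is a line passing through exactly $k$ nodes of $\mathcal X$; a maximal line of an $n$-poised (in particular $GC_n$) set is an $(n+1)$-node line. $\mathcal X_\ell$ denotes the set of nodes of $\mathcal X$ which use the line $\ell$. Conventions for small $n$: $\binom{m}{2}=m(m-1)/2$; a $GC_0$ set is a single point; for $k<0$ a $GC_k$ set means the empty set. *)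

theory Defs
  imports Complex_Main "HOL-Computational_Algebra.Polynomial"
begin

type_synonym point = "real \<times> real"

text \<open>
  A bivariate real polynomial is an element of \<open>real poly poly\<close>, i.e. a polynomial in y whose
  coefficients are polynomials in x; \<open>coeff (coeff p j) i\<close> is the coefficient of \<open>x ^ i * y ^ j\<close>.
\<close>

type_synonym bipoly = "real poly poly"

definition eval2 :: "bipoly \<Rightarrow> point \<Rightarrow> real" where
  "eval2 p A = poly (poly p [:snd A:]) (fst A)"

text \<open>Polynomials of total degree at most \<open>n\<close>.\<close>

definition bipolys :: "nat \<Rightarrow> bipoly set" where
  "bipolys n = {p. \<forall>i j. coeff (coeff p j) i \<noteq> 0 \<longrightarrow> i + j \<le> n}"

definition deg_one :: "bipoly \<Rightarrow> bool" where
  "deg_one p \<longleftrightarrow> p \<in> bipolys 1 \<and> p \<notin> bipolys 0"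

definition zero_set :: "bipoly \<Rightarrow> point set" where
  "zero_set p = {A. eval2 p A = 0}"

text \<open>
  Lines are represented as point sets. A line determines the degree-one polynomial defining it up
  to a nonzero scalar, so \<open>uses_line\<close> below does not depend on which one is chosen.
\<close>

definition is_line :: "point set \<Rightarrow> bool" where
  "is_line L \<longleftrightarrow> (\<exists>l. deg_one l \<and> L = zero_set l)"

definition poised :: "nat \<Rightarrow> point set \<Rightarrow> bool" where
  "poised n X \<longleftrightarrow> finite X \<and>
     (\<forall>c :: point \<Rightarrow> real. \<exists>!p. p \<in> bipolys n \<and> (\<forall>A\<in>X. eval2 p A = c A))"

text \<open>Meaningful only if \<open>X\<close> is \<open>n\<close>-poised and \<open>A \<in> X\<close>.\<close>

definition fundamental_poly :: "nat \<Rightarrow> point set \<Rightarrow> point \<Rightarrow> bipoly" where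
  "fundamental_poly n X A =
     (THE p. p \<in> bipolys n \<and> eval2 p A = 1 \<and> (\<forall>B\<in>X - {A}. eval2 p B = 0))"

definition GC_nat :: "nat \<Rightarrow> point set \<Rightarrow> bool" where
  "GC_nat n X \<longleftrightarrow> poised n X \<and>
     (\<forall>A\<in>X. \<exists>ls. length ls = n \<and> (\<forall>l\<in>set ls. deg_one l) \<and> fundamental_poly n X A = prod_list ls)"

text \<open>The degree is an integer: for a negative degree only the empty set is a GC set.\<close>

definition GC_set :: "int \<Rightarrow> point set \<Rightarrow> bool" where
  "GC_set k X \<longleftrightarrow> (if k < 0 then X = {} else GC_nat (nat k) X)"

definition uses_line :: "nat \<Rightarrow> point set \<Rightarrow> point \<Rightarrow> point set \<Rightarrow> bool" where
  "uses_line n X A L \<longleftrightarrow>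
     (\<exists>l q. deg_one l \<and> zero_set l = L \<and> q \<in> bipolys (n - 1) \<and> fundamental_poly n X A = l * q)"

definition node_line :: "nat \<Rightarrow> point set \<Rightarrow> point set \<Rightarrow> bool" where
  "node_line k X L \<longleftrightarrow> is_line L \<and> card (X \<inter> L) = k"

definition maximal_line :: "nat \<Rightarrow> point set \<Rightarrow> point set \<Rightarrow> bool" where
  "maximal_line n X M \<longleftrightarrow> node_line (n + 1) X M"

definition users :: "nat \<Rightarrow> point set \<Rightarrow> point set \<Rightarrow> point set" where
  "users n X L = {A \<in> X. uses_line n X A L}"

definition GM_conjecture :: "nat \<Rightarrow> bool" where
  "GM_conjecture k \<longleftrightarrow> (\<forall>X. GC_set (int k) X \<longrightarrow> (\<exists>M. maximal_line k X M))"

end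

theory Submission
  imports Defs
begin

text \<open>
  In a \<open>GC_n\<close> set the \<open>n\<close> lines of a fundamental polynomial cover all other nodes, and \<open>n\<close> lines can cover
  at most \<open>n\<close> points of any further line. This counting shows that maximal lines meet in nodes, that removing
  one gives a \<open>GC_(n-1)\<close> set, and which nodes use \<open>L\<close> in the configurations (i) and (ii). It remains to
  see that one of the two configurations occurs.

  There are at least three maximal lines, by induction on \<open>n\<close>. A maximal line of \<open>X - M\<close> is maximal in \<open>X\<close> or
  shares no node with \<open>M\<close>. If \<open>K1\<close>, \<open>K2\<close> are of the second kind and meet in \<open>C\<close>, then sending a node \<open>B\<close> of \<open>M\<close>
  to the node of \<open>M\<close> on the factor of its fundamental polynomial through \<open>C\<close> is an involution without
  fixed points, and this is incompatible with a third maximal line of \<open>X - M\<close>.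

  Suppose that neither configuration occurs. If \<open>n \<ge> 5\<close>, compare the nodes using \<open>L\<close> in \<open>X - M\<close> and in \<open>X - M'\<close> for
  two maximal lines: by induction their complements are covered by at most two lines each, which must be the
  same lines and hence maximal in \<open>X\<close>, a contradiction. The degrees \<open>n \<le> 4\<close> are treated directly, \<open>n = 4\<close>
  by analysing how pairs of lines can cover the few nodes outside the maximal lines.
\<close>
section \<open>Bivariate polynomials\<close>

lemma bipolys_iff: "p \<in> bipolys n \<longleftrightarrow> (\<forall>i j. n < i + j \<longrightarrow> coeff (coeff p j) i = 0)"
  unfolding bipolys_def by (auto simp: not_le[symmetric])

lemma eval2_mult [simp]: "eval2 (p * q) A = eval2 p A * eval2 q A"
  and eval2_add [simp]: "eval2 (p + q) A = eval2 p A + eval2 q A"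
  and eval2_diff [simp]: "eval2 (p - q) A = eval2 p A - eval2 q A"
  and eval2_0 [simp]: "eval2 0 A = 0"
  and eval2_1 [simp]: "eval2 1 A = 1"
  and eval2_smult [simp]: "eval2 (smult [:c:] p) A = c * eval2 p A"
  by (simp_all add: eval2_def)

lemma eval2_pCons: "eval2 (pCons a p) A = poly a (fst A) + snd A * eval2 p A"
  by (simp add: eval2_def)

lemma bipolys_mult:
  assumes "p \<in> bipolys m" "q \<in> bipolys n" shows "p * q \<in> bipolys (m + n)"
  unfolding bipolys_iff
proof (intro allI impI)
  fix i j :: nat assume ij: "m + n < i + j"
  have "coeff (coeff (p * q) j) i =
      (\<Sum>k\<le>j. \<Sum>h\<le>i. coeff (coeff p k) h * coeff (coeff q (j - k)) (i - h))"
    by (simp add: coeff_mult coeff_sum)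
  also have "\<dots> = 0"
  proof (intro sum.neutral ballI)
    fix k h assume kh: "k \<in> {..j}" "h \<in> {..i}"
    then have "m < h + k \<or> n < (i - h) + (j - k)" using ij by auto
    then show "coeff (coeff p k) h * coeff (coeff q (j - k)) (i - h) = 0"
      using assms unfolding bipolys_iff by auto
  qed
  finally show "coeff (coeff (p * q) j) i = 0" .
qed

lemma bipolys_diff: "p \<in> bipolys n \<Longrightarrow> q \<in> bipolys n \<Longrightarrow> p - q \<in> bipolys n"
  by (simp add: bipolys_iff)

lemma bipolys_smult: "p \<in> bipolys n \<Longrightarrow> smult [:c:] p \<in> bipolys n"
  by (simp add: bipolys_iff)

lemma bipolys_zero: "0 \<in> bipolys n"
  by (simp add: bipolys_iff)

lemma bipolys_one: "1 \<in> bipolys n"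
  by (auto simp: bipolys_def coeff_1 split: if_splits)

lemma deg_one_iff:
  "deg_one l \<longleftrightarrow> (\<exists>a b c. (b \<noteq> 0 \<or> c \<noteq> 0) \<and> l = [:[:a, b:], [:c:]:])"
proof
  assume "deg_one l"
  then have l: "l \<in> bipolys 1" "l \<notin> bipolys 0" by (auto simp: deg_one_def)
  define a b c where "a = coeff (coeff l 0) 0" and "b = coeff (coeff l 0) 1" and "c = coeff (coeff l 1) 0"
  have "coeff (coeff l j) i = coeff (coeff [:[:a, b:], [:c:]:] j) i" for i j
  proof (cases "1 < i + j")
    case True
    then show ?thesis using l(1)
      by (auto simp: bipolys_iff coeff_pCons split: nat.splits)
  next
    case False
    then have "(i, j) \<in> {(0,0),(0,1),(1,0)}" by auto
    then show ?thesis by (auto simp: a_def b_def c_def)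
  qed
  then have eq: "l = [:[:a, b:], [:c:]:]" by (intro poly_eqI) blast
  moreover have "b \<noteq> 0 \<or> c \<noteq> 0"
  proof (rule ccontr)
    assume "\<not> (b \<noteq> 0 \<or> c \<noteq> 0)"
    then have "l = [:[:a:]:]" using eq by simp
    then have "coeff (coeff l j) i = 0" if "0 < i + j" for i j
      using that by (cases i; cases j) auto
    then show False using l(2) by (auto simp: bipolys_iff)
  qed
  ultimately show "\<exists>a b c. (b \<noteq> 0 \<or> c \<noteq> 0) \<and> l = [:[:a, b:], [:c:]:]" by blast
next
  assume "\<exists>a b c. (b \<noteq> 0 \<or> c \<noteq> 0) \<and> l = [:[:a, b:], [:c:]:]"
  then obtain a b c where *: "b \<noteq> 0 \<or> c \<noteq> 0" "l = [:[:a, b:], [:c:]:]" by blast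
  have "l \<in> bipolys 1" unfolding *(2) bipolys_iff
    by (auto simp: coeff_pCons split: nat.splits)
  moreover have "l \<notin> bipolys 0"
  proof
    assume "l \<in> bipolys 0"
    then have "coeff (coeff l 0) 1 = 0" "coeff (coeff l 1) 0 = 0" unfolding bipolys_iff by auto
    then show False using * by auto
  qed
  ultimately show "deg_one l" by (simp add: deg_one_def)
qed

lemma eval2_linear: "eval2 [:[:a, b:], [:c:]:] A = a + b * fst A + c * snd A"
  by (simp add: eval2_def algebra_simps)

lemma poly_poly_eq_eval2: "poly (poly p r) x = eval2 p (x, poly r x)"
  by (induction p) (auto simp: eval2_pCons)

section \<open>Divisibility by the equation of a line\<close>

lemma bipolys_degree:
  assumes "p \<in> bipolys n" "coeff p j \<noteq> 0" shows "degree (coeff p j) + j \<le> n"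
  using assms leading_coeff_neq_0 unfolding bipolys_def by blast

text \<open>The coefficient of \<open>y ^ (j + 1)\<close> in \<open>(y - r) * Q\<close> is
  \<open>Q_j - r * Q_(j+1)\<close>. Multiplication by \<open>r\<close> raises the degree in
  \<open>x\<close> by at most one, so the bound passes from \<open>Q_(j+1)\<close> down to
  \<open>Q_j\<close>; the induction starts above the degree of \<open>Q\<close>.\<close>

lemma bipolys_linear_factor:
  fixes Q :: bipoly
  assumes p: "[:-r, 1:] * Q \<in> bipolys n" and r: "degree r \<le> 1"
  shows "n \<le> i + j \<Longrightarrow> coeff (coeff Q j) i = 0"
proof (induction "Suc (degree Q) - j" arbitrary: i j)
  case 0
  then show ?case by (simp add: coeff_eq_0)
next
  case (Suc d)
  have IH: "coeff (coeff Q (Suc j)) i' = 0" if "n \<le> Suc (i' + j)" for i'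
    using Suc.hyps that by simp
  have r': "r = [:coeff r 0, coeff r 1:]"
    using r by (intro poly_eqI) (auto simp: coeff_pCons coeff_eq_0 split: nat.splits)
  have "coeff (r * coeff Q (Suc j)) i = 0"
    using Suc.prems by (subst r', cases i) (auto simp: IH)
  moreover have "coeff (coeff ([:-r, 1:] * Q) (Suc j)) i = 0"
    using p[unfolded bipolys_iff, rule_format, of i "Suc j"] Suc.prems by linarith
  ultimately show ?case by simp
qed

lemma poly_eq_0_of_card:
  fixes p :: "real poly"
  assumes "degree p \<le> n" "n < card S" "S \<subseteq> {x. poly p x = 0}"
  shows "p = 0"
proof (rule ccontr)
  assume "p \<noteq> 0"
  then have "card S \<le> card {x. poly p x = 0}" "card {x. poly p x = 0} \<le> degree p"
    using assms(3) poly_roots_finite by (auto intro: card_mono card_poly_roots_bound)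
  then show False using assms by linarith
qed

text \<open>Restricted to the line, \<open>p\<close> becomes a univariate polynomial of degree at
  most \<open>n\<close> with more than \<open>n\<close> zeros, hence zero. Synthetic division then
  yields the quotient: in \<open>y\<close> if the line is a graph over \<open>x\<close>, and
  coefficientwise in \<open>x\<close> if it is vertical.\<close>

lemma line_divides:
  assumes l: "deg_one l" and p: "p \<in> bipolys n" and S: "S \<subseteq> zero_set l" "n < card S"
    and z: "\<And>P. P \<in> S \<Longrightarrow> eval2 p P = 0"
  shows "\<exists>q\<in>bipolys (n - 1). p = l * q"
proof -
  obtain a b c where bc: "b \<noteq> 0 \<or> c \<noteq> 0" and l_eq: "l = [:[:a, b:], [:c:]:]"
    using l deg_one_iff by blast
  have on_line: "a + b * fst P + c * snd P = 0" if "P \<in> S" for P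
    using that S(1) by (auto simp: zero_set_def l_eq eval2_linear)
  show ?thesis
  proof (cases "c = 0")
    case False
    define r where "r = [:-a / c, -b / c:]"
    have snd_eq: "snd P = poly r (fst P)" if "P \<in> S" for P
      using on_line[OF that] False by (simp add: r_def field_simps)
    have "degree (poly p r) \<le> n"
    proof -
      have "degree (coeff p j * r ^ j) \<le> n" for j
      proof (cases "coeff p j = 0")
        case False
        have "degree (r ^ j) \<le> degree r * j" by (rule degree_power_le)
        also have "\<dots> \<le> 1 * j" by (rule mult_right_mono) (auto simp: r_def)
        finally show ?thesis
          using bipolys_degree[OF p False] degree_mult_le[of "coeff p j" "r ^ j"] by linarith
      qed auto
      then show ?thesis unfolding poly_altdef by (intro degree_sum_le) auto
    qed
    moreover have "inj_on fst S"
      by (intro inj_onI) (simp add: prod_eq_iff snd_eq)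
    then have "n < card (fst ` S)" using S(2) by (simp add: card_image)
    moreover have "fst ` S \<subseteq> {x. poly (poly p r) x = 0}"
      using z snd_eq by (auto simp: poly_poly_eq_eval2)
    ultimately have "poly p r = 0"
      using poly_eq_0_of_card[of "poly p r" n "fst ` S"] by blast
    then have p_eq: "[:-r, 1:] * synthetic_div p r = p"
      using synthetic_div_correct'[of r p] by simp
    have "synthetic_div p r \<in> bipolys (n - 1)"
      using bipolys_linear_factor[of r "synthetic_div p r" n] p_eq p
      unfolding bipolys_iff[of _ "n - 1"] by (auto simp: r_def)
    then have "smult [:1 / c:] (synthetic_div p r) \<in> bipolys (n - 1)"
      by (rule bipolys_smult)
    moreover have "l = smult [:c:] [:-r, 1:]"
      using False by (simp add: l_eq r_def)
    then have "l * smult [:1 / c:] (synthetic_div p r)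
        = smult ([:1 / c:] * [:c:]) ([:-r, 1:] * synthetic_div p r)"
      by (simp only: mult_smult_left mult_smult_right smult_smult)
    then have "p = l * smult [:1 / c:] (synthetic_div p r)"
      unfolding p_eq using False by (simp flip: one_pCons)
    ultimately show ?thesis by blast
  next
    case True
    with bc have b: "b \<noteq> 0" by simp
    define x where "x = - a / b"
    have fst_eq: "fst P = x" if "P \<in> S" for P
      using on_line[OF that] b True by (simp add: x_def field_simps)
    \<comment> \<open>\<open>g\<close> is the restriction of \<open>p\<close> to the vertical line,
      as a polynomial in \<open>y\<close>.\<close>
    define g where "g = map_poly (\<lambda>u. poly u x) p"
    have g: "poly g y = eval2 p (x, y)" for y
      unfolding g_def by (induction p) (auto simp: map_poly_pCons eval2_pCons)
    have "inj_on snd S"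
      by (intro inj_onI) (simp add: prod_eq_iff fst_eq)
    then have "n < card (snd ` S)" using S(2) by (simp add: card_image)
    moreover have "snd ` S \<subseteq> {y. poly g y = 0}"
      using z by (auto simp: g) (metis fst_eq prod.collapse snd_conv fst_conv)
    moreover have "degree g \<le> n"
      unfolding g_def
    proof (rule degree_le, intro allI impI)
      fix j assume "n < j"
      then have "coeff p j = 0" using bipolys_degree[OF p, of j] by linarith
      then show "coeff (map_poly (\<lambda>u. poly u x) p) j = 0" by (simp add: coeff_map_poly)
    qed
    ultimately have "g = 0"
      using poly_eq_0_of_card[of g n "snd ` S"] by blast
    then have root: "poly (coeff p j) x = 0" for j
      by (metis coeff_map_poly coeff_0 g_def poly_0)
    define q where "q = map_poly (\<lambda>u. synthetic_div u x) p"
    have qj: "coeff q j = synthetic_div (coeff p j) x" for j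
      by (simp add: q_def coeff_map_poly)
    have pj: "[:-x, 1:] * coeff q j = coeff p j" for j
      using synthetic_div_correct'[of x "coeff p j"] by (simp add: qj root)
    have "q \<in> bipolys (n - 1)"
      unfolding bipolys_iff
    proof (intro allI impI)
      fix i j assume ij: "n - 1 < i + j"
      show "coeff (coeff q j) i = 0"
      proof (cases "coeff q j = 0")
        case False
        then have "degree (coeff p j) = Suc (degree (coeff q j))"
          by (subst pj[symmetric], subst degree_mult_eq) auto
        moreover from this have "coeff p j \<noteq> 0" by force
        ultimately have "degree (coeff q j) < i"
          using bipolys_degree[OF p, of j] ij by linarith
        then show ?thesis by (rule coeff_eq_0)
      qed auto
    qed
    then have "smult [:1 / b:] q \<in> bipolys (n - 1)" by (rule bipolys_smult)
    moreover have "p = l * smult [:1 / b:] q"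
    proof (rule poly_eqI)
      fix j
      have "coeff (l * smult [:1 / b:] q) j = [:a, b:] * coeff (smult [:1 / b:] q) j"
      proof -
        have "coeff ([:u:] * r) j = u * coeff r j" for u :: "real poly" and r by simp
        then show ?thesis using True unfolding l_eq by (metis pCons_0_0)
      qed
      also have "coeff (smult [:1 / b:] q) j = smult (1 / b) (coeff q j)"
        by simp
      also have "[:a, b:] = smult b [:-x, 1:]" using b by (simp add: x_def)
      finally show "coeff p j = coeff (l * smult [:1 / b:] q) j"
        using b by (simp only: mult_smult_left mult_smult_right smult_smult pj) simp
    qed
    ultimately show ?thesis by blast
  qed
qed

section \<open>Lines and covers by lines\<close>

lemma deg_one_smult: "deg_one l \<Longrightarrow> c \<noteq> 0 \<Longrightarrow> deg_one (smult [:c:] l)"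
  unfolding deg_one_iff by force

lemma deg_one_bipolys: "deg_one l \<Longrightarrow> l \<in> bipolys 1"
  by (simp add: deg_one_def)

lemma is_line_iff:
  "is_line L \<longleftrightarrow> (\<exists>a b c. (b \<noteq> 0 \<or> c \<noteq> 0) \<and> L = {P. a + b * fst P + c * snd P = 0})"
proof
  assume "is_line L"
  then obtain a b c where "b \<noteq> 0 \<or> c \<noteq> 0" "L = zero_set [:[:a, b:], [:c:]:]"
    unfolding is_line_def deg_one_iff by blast
  then show "\<exists>a b c. (b \<noteq> 0 \<or> c \<noteq> 0) \<and> L = {P. a + b * fst P + c * snd P = 0}"
    unfolding zero_set_def eval2_linear by blast
next
  assume "\<exists>a b c. (b \<noteq> 0 \<or> c \<noteq> 0) \<and> L = {P. a + b * fst P + c * snd P = 0}"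
  then obtain a b c where "b \<noteq> 0 \<or> c \<noteq> 0" "L = zero_set [:[:a, b:], [:c:]:]"
    unfolding zero_set_def eval2_linear by blast
  then show "is_line L" unfolding is_line_def deg_one_iff by blast
qed

lemma deg_one_affine:
  assumes "deg_one l"
  shows "eval2 l (fst P + t * (fst Q - fst P), snd P + t * (snd Q - snd P))
      = (1 - t) * eval2 l P + t * eval2 l Q"
  using assms unfolding deg_one_iff by (auto simp: eval2_linear algebra_simps)

text \<open>A determinant condition: \<open>R - P\<close> is parallel to \<open>Q - P\<close>. For
  \<open>P = Q\<close> it defines the whole plane, so the points are kept distinct wherever a line
  is needed.\<close>

definition join :: "point \<Rightarrow> point \<Rightarrow> point set" where
  "join P Q = {R. (fst Q - fst P) * (snd R - snd P) = (snd Q - snd P) * (fst R - fst P)}"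

lemma is_line_join: "P \<noteq> Q \<Longrightarrow> is_line (join P Q)"
  unfolding is_line_iff join_def
  by (intro exI[of _ "(snd Q - snd P) * fst P - (fst Q - fst P) * snd P"]
        exI[of _ "- (snd Q - snd P)"] exI[of _ "fst Q - fst P"])
     (auto simp: algebra_simps prod_eq_iff)

lemma join_mem [simp]: "P \<in> join P Q" "Q \<in> join P Q"
  by (auto simp: join_def)

lemma line_eq_join:
  assumes "is_line L" "P \<in> L" "Q \<in> L" "P \<noteq> Q" shows "L = join P Q"
proof -
  obtain a b c where bc: "b \<noteq> 0 \<or> c \<noteq> 0" and L: "L = {P. a + b * fst P + c * snd P = 0}"
    using assms(1)[unfolded is_line_iff] by blast
  define u v where "u = fst Q - fst P" and "v = snd Q - snd P"
  have uv: "b * u + c * v = 0" "u \<noteq> 0 \<or> v \<noteq> 0"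
    using assms(2-4) by (auto simp: L u_def v_def algebra_simps prod_eq_iff)
  \<comment> \<open>The coefficient vector \<open>(b, c)\<close> is orthogonal to the direction
    \<open>(u, v)\<close>, so it is a nonzero multiple of \<open>(- v, u)\<close>.\<close>
  obtain k where k: "k \<noteq> 0" "b = - k * v" "c = k * u"
  proof (cases "u = 0")
    case True
    with uv bc show ?thesis by (intro that[of "- b / v"]) auto
  next
    case False
    have "b * u = - c * v" using uv(1) by simp
    then have b: "b = - (c / u) * v" using False by (simp add: field_simps)
    then have "c \<noteq> 0" using bc by auto
    then show ?thesis using b False by (intro that[of "c / u"]) auto
  qed
  have "a + b * fst R + c * snd R = k * (u * (snd R - snd P) - v * (fst R - fst P))" for R
    using assms(2) by (auto simp: L k algebra_simps)
  then show ?thesis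
    using k(1) by (auto simp: L join_def u_def v_def)
qed

lemma line_eqI:
  "is_line L \<Longrightarrow> is_line L' \<Longrightarrow> P \<in> L \<Longrightarrow> Q \<in> L \<Longrightarrow> P \<in> L' \<Longrightarrow> Q \<in> L' \<Longrightarrow> P \<noteq> Q \<Longrightarrow> L = L'"
  using line_eq_join by metis

lemma infinite_line: assumes "is_line L" shows "infinite L"
proof -
  obtain a b c where bc: "b \<noteq> 0 \<or> c \<noteq> 0" and L: "L = {P. a + b * fst P + c * snd P = 0}"
    using assms[unfolded is_line_iff] by blast
  show ?thesis
  proof (cases "c = 0")
    case True
    with bc have "range (\<lambda>y. (- a / b, y)) \<subseteq> L" by (auto simp: L)
    moreover have "infinite (range (\<lambda>y::real. (- a / b, y)))"
      using finite_imageD[of "\<lambda>y::real. (- a / b, y)" UNIV] infinite_UNIV_char_0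
      by (auto simp: inj_on_def)
    ultimately show ?thesis using finite_subset by blast
  next
    case False
    then have "range (\<lambda>x. (x, - (a + b * x) / c)) \<subseteq> L" by (auto simp: L)
    moreover have "infinite (range (\<lambda>x::real. (x, - (a + b * x) / c)))"
      using finite_imageD[of "\<lambda>x::real. (x, - (a + b * x) / c)" UNIV] infinite_UNIV_char_0
      by (auto simp: inj_on_def)
    ultimately show ?thesis using finite_subset by blast
  qed
qed

lemma card_inter_lines:
  assumes "is_line L" "is_line K" "L \<noteq> K" shows "card (S \<inter> L \<inter> K) \<le> 1"
proof -
  have "\<exists>P. S \<inter> L \<inter> K \<subseteq> {P}" using line_eqI[OF assms(1,2)] assms(3) by blast
  then obtain P where "S \<inter> L \<inter> K \<subseteq> {P}" by blast
  then have "card (S \<inter> L \<inter> K) \<le> card {P}" by (intro card_mono) auto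
  then show ?thesis by simp
qed

text \<open>Each line of the list differs from \<open>L\<close> and takes at most one point of it.
  Most later counts of nodes against factors come from this bound.\<close>

lemma card_cover_le:
  assumes "\<forall>K\<in>set ls. is_line K" "is_line L" "L \<notin> set ls" "S \<subseteq> L" "S \<subseteq> \<Union>(set ls)"
  shows "card S \<le> length ls"
  using assms
proof (induction ls arbitrary: S)
  case (Cons K ls)
  have "card S \<le> card (S \<inter> L \<inter> K) + card (S - K)"
    using card_Un_le[of "S \<inter> L \<inter> K" "S - K"] Cons.prems(4) by (metis Int_Diff_Un Int_absorb2)
  moreover have "card (S \<inter> L \<inter> K) \<le> 1"
    using Cons.prems by (intro card_inter_lines) auto
  moreover have "card (S - K) \<le> length ls"
    using Cons.prems by (intro Cons.IH) auto
  ultimately show ?case by simp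
qed auto

text \<open>Finitely many other lines contain only finitely many points of the infinite set
  \<open>L\<close>. This replaces unique factorisation when a line divides a product of
  lines.\<close>

lemma line_in_cover:
  assumes "\<forall>K\<in>set ls. is_line K" "is_line L" "L \<subseteq> \<Union>(set ls)" shows "L \<in> set ls"
proof (rule ccontr)
  assume "L \<notin> set ls"
  moreover obtain S where "S \<subseteq> L" "card S = Suc (length ls)"
    using infinite_line[OF assms(2)] infinite_arbitrarily_large by metis
  ultimately show False using card_cover_le[of ls L S] assms by auto
qed

context
  fixes ls :: "point set list" and L S :: "point set"
  assumes lines: "\<forall>K\<in>set ls. is_line K" "is_line L" "L \<notin> set ls"
    and S: "S \<subseteq> L" "S \<subseteq> \<Union>(set ls)" "length ls \<le> card S"
begin

text \<open>A line missing \<open>S\<close> could be dropped from the list, and too few lines would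
  be left for \<open>S\<close>.\<close>

lemma tight_cover_meets: assumes "K \<in> set ls" shows "\<exists>P\<in>S. P \<in> K"
proof (rule ccontr)
  assume neg: "\<not> ?thesis"
  have "S \<subseteq> \<Union>(set (remove1 K ls))"
  proof
    fix P assume "P \<in> S"
    then obtain K' where "K' \<in> set ls" "P \<in> K'" "K' \<noteq> K" using S(2) neg by blast
    then have "K' \<in> set (remove1 K ls)" by (simp add: in_set_remove1)
    then show "P \<in> \<Union>(set (remove1 K ls))" using \<open>P \<in> K'\<close> by blast
  qed
  then have "card S \<le> length (remove1 K ls)"
    using lines S(1) set_remove1_subset[of K ls] by (intro card_cover_le[of _ L]) auto
  then have "card S \<le> length ls - 1" using assms by (simp add: length_remove1)
  then show False using S(3) length_pos_if_in_set[OF assms] by linarith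
qed

text \<open>\<open>K\<close> meets \<open>L\<close> only in \<open>P\<close>, so if another entry
  also covered \<open>P\<close>, then \<open>K\<close> could be dropped. With
  \<open>remove1\<close>, \<open>K'\<close> may be a second copy of \<open>K\<close>.\<close>

lemma tight_cover_unique:
  assumes "K \<in> set ls" "P \<in> K" "P \<in> S" "K' \<in> set (remove1 K ls)" shows "P \<notin> K'"
proof
  assume P: "P \<in> K'"
  have "S \<subseteq> \<Union>(set (remove1 K ls))"
  proof
    fix Q assume Q: "Q \<in> S"
    show "Q \<in> \<Union>(set (remove1 K ls))"
    proof (cases "Q = P")
      case True then show ?thesis using P assms by blast
    next
      case False
      then have "Q \<notin> K"
        using line_eqI[of K L P Q] assms lines Q S(1) by auto
      moreover obtain K'' where "K'' \<in> set ls" "Q \<in> K''" using Q S(2) by blast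
      moreover from calculation have "K'' \<in> set (remove1 K ls)"
        using in_set_remove1[of K'' K ls] by metis
      ultimately show ?thesis by blast
    qed
  qed
  then have "card S \<le> length (remove1 K ls)"
    using lines S(1) set_remove1_subset[of K ls] by (intro card_cover_le[of _ L]) auto
  then have "card S \<le> length ls - 1" using assms by (simp add: length_remove1)
  then show False using S(3) length_pos_if_in_set[OF assms(1)] by linarith
qed

end

section \<open>Products of linear factors and fundamental polynomials\<close>

definition line_poly :: "point set \<Rightarrow> bipoly" where
  "line_poly L = (SOME l. deg_one l \<and> L = zero_set l)"

lemma line_poly: assumes "is_line L"
  shows "deg_one (line_poly L)" "zero_set (line_poly L) = L"
  using someI_ex[OF assms[unfolded is_line_def]] unfolding line_poly_def by auto

lemma eval2_line_poly: "is_line L \<Longrightarrow> eval2 (line_poly L) P = 0 \<longleftrightarrow> P \<in> L"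
  using line_poly(2)[of L] by (auto simp: zero_set_def)

definition lines_poly :: "point set list \<Rightarrow> bipoly" where
  "lines_poly ls = prod_list (map line_poly ls)"

lemma eval2_prod_list: "eval2 (prod_list ps) A = prod_list (map (\<lambda>p. eval2 p A) ps)"
  by (induction ps) auto

lemma eval2_lines_poly:
  "\<forall>K\<in>set ls. is_line K \<Longrightarrow> eval2 (lines_poly ls) P = 0 \<longleftrightarrow> P \<in> \<Union>(set ls)"
  by (auto simp: lines_poly_def eval2_prod_list prod_list_zero_iff image_iff eval2_line_poly)

lemma prod_list_bipolys: "\<forall>l\<in>set ls. deg_one l \<Longrightarrow> prod_list ls \<in> bipolys (length ls)"
proof (induction ls)
  case (Cons l ls)
  then show ?case using bipolys_mult[of l 1 "prod_list ls" "length ls"] deg_one_bipolys[of l]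
    by simp
qed (simp add: bipolys_one)

lemma lines_poly_bipolys: "\<forall>K\<in>set ls. is_line K \<Longrightarrow> lines_poly ls \<in> bipolys (length ls)"
  unfolding lines_poly_def using prod_list_bipolys[of "map line_poly ls"]
  by (auto simp: line_poly)

lemma lines_poly_remove1:
  "K \<in> set ls \<Longrightarrow> lines_poly ls = line_poly K * lines_poly (remove1 K ls)"
  unfolding lines_poly_def by (induction ls) (auto simp: mult.left_commute)

lemma poised_eq_0:
  assumes "poised n X" "p \<in> bipolys n" "\<And>A. A \<in> X \<Longrightarrow> eval2 p A = 0" shows "p = 0"
  using assms(1)[unfolded poised_def, THEN conjunct2, rule_format, of "\<lambda>_. 0"] assms(2,3)
    bipolys_zero[of n] by (metis eval2_0)

lemma fundamental_poly:
  assumes "poised n X" "A \<in> X"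
  shows "fundamental_poly n X A \<in> bipolys n" "eval2 (fundamental_poly n X A) A = 1"
    "\<And>B. B \<in> X - {A} \<Longrightarrow> eval2 (fundamental_poly n X A) B = 0"
proof -
  let ?P = "\<lambda>p. p \<in> bipolys n \<and> eval2 p A = 1 \<and> (\<forall>B\<in>X - {A}. eval2 p B = 0)"
  let ?c = "\<lambda>B. if B = A then 1 else 0"
  have "\<exists>!p. p \<in> bipolys n \<and> (\<forall>B\<in>X. eval2 p B = ?c B)"
    by (rule assms(1)[unfolded poised_def, THEN conjunct2, THEN spec])
  moreover have "(\<forall>B\<in>X. eval2 p B = ?c B) \<longleftrightarrow> eval2 p A = 1 \<and> (\<forall>B\<in>X - {A}. eval2 p B = 0)" for p
    using assms(2) by auto
  ultimately have "\<exists>!p. ?P p" by simp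
  from theI'[OF this] have "?P (fundamental_poly n X A)" unfolding fundamental_poly_def .
  then show "fundamental_poly n X A \<in> bipolys n" "eval2 (fundamental_poly n X A) A = 1"
    "\<And>B. B \<in> X - {A} \<Longrightarrow> eval2 (fundamental_poly n X A) B = 0" by auto
qed

lemma eq_fundamental_poly:
  assumes "poised n X" "A \<in> X" "p \<in> bipolys n" "\<And>B. B \<in> X - {A} \<Longrightarrow> eval2 p B = 0"
  shows "p = smult [:eval2 p A:] (fundamental_poly n X A)"
proof -
  let ?f = "fundamental_poly n X A"
  have "p - smult [:eval2 p A:] ?f = 0"
  proof (rule poised_eq_0[OF assms(1)])
    show "p - smult [:eval2 p A:] ?f \<in> bipolys n"
      using assms fundamental_poly by (intro bipolys_diff bipolys_smult) auto
    show "eval2 (p - smult [:eval2 p A:] ?f) B = 0" if "B \<in> X" for B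
      using that assms fundamental_poly[OF assms(1,2)] by (cases "B = A") auto
  qed
  then show ?thesis by simp
qed

text \<open>A list rather than a set of lines: a factor may be repeated.\<close>

definition line_cover :: "nat \<Rightarrow> point set \<Rightarrow> point \<Rightarrow> point set list \<Rightarrow> bool" where
  "line_cover n X A ls \<longleftrightarrow>
     length ls = n \<and> (\<forall>K\<in>set ls. is_line K \<and> A \<notin> K) \<and> X - {A} \<subseteq> \<Union>(set ls)"

lemma line_coverD:
  assumes "line_cover n X A ls"
  shows "length ls = n" "\<forall>K\<in>set ls. is_line K" "\<And>K. K \<in> set ls \<Longrightarrow> A \<notin> K"
    "\<And>P. P \<in> X \<Longrightarrow> P \<noteq> A \<Longrightarrow> \<exists>K\<in>set ls. P \<in> K"
  using assms unfolding line_cover_def by blast+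

text \<open>By uniqueness of interpolation, a product of \<open>n\<close> lines that vanishes at
  every node except \<open>A\<close> is a multiple of the fundamental polynomial; the multiple is
  nonzero because no line passes through \<open>A\<close>.\<close>

lemma line_cover_fundamental:
  assumes "poised n X" "A \<in> X" "line_cover n X A ls"
  shows "\<exists>c. c \<noteq> 0 \<and> fundamental_poly n X A = smult [:c:] (lines_poly ls)"
proof -
  define a where "a = eval2 (lines_poly ls) A"
  have ls: "\<forall>K\<in>set ls. is_line K" "length ls = n" using assms(3) by (auto simp: line_cover_def)
  have a: "a \<noteq> 0" using assms(3) eval2_lines_poly[OF ls(1)] by (auto simp: line_cover_def a_def)
  have eq: "lines_poly ls = smult [:a:] (fundamental_poly n X A)"
    unfolding a_def using assms eval2_lines_poly[OF ls(1)] lines_poly_bipolys[OF ls(1)] ls(2)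
    by (intro eq_fundamental_poly) (auto simp: line_cover_def)
  have "smult [:1 / a:] (lines_poly ls) = smult ([:1 / a:] * [:a:]) (fundamental_poly n X A)"
    unfolding eq by (simp only: smult_smult)
  also have "[:1 / a:] * [:a:] = 1" using a by (simp flip: one_pCons)
  finally show ?thesis using a by (intro exI[of _ "1 / a"]) auto
qed

text \<open>The zero sets of the factors form a cover. Conversely, the product of a cover is right
  up to a scalar, which is absorbed into the first factor. Later arguments mostly use this geometric
  form.\<close>

lemma GC_nat_iff: "GC_nat n X \<longleftrightarrow> poised n X \<and> (\<forall>A\<in>X. \<exists>ls. line_cover n X A ls)"
proof (intro iffI conjI ballI)
  fix A assume GC: "GC_nat n X" and A: "A \<in> X"
  then have X: "poised n X" by (simp add: GC_nat_def)
  obtain ls where ls: "length ls = n" "\<forall>l\<in>set ls. deg_one l" "fundamental_poly n X A = prod_list ls"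
    using GC A by (auto simp: GC_nat_def)
  have zero: "eval2 (fundamental_poly n X A) B = 0 \<longleftrightarrow> B \<in> \<Union>(set (map zero_set ls))" for B
    by (auto simp: ls(3) eval2_prod_list prod_list_zero_iff zero_set_def)
  have "line_cover n X A (map zero_set ls)"
    unfolding line_cover_def
  proof (intro conjI ballI)
    show "X - {A} \<subseteq> \<Union>(set (map zero_set ls))"
      using zero fundamental_poly(3)[OF X A] by blast
    show "is_line K" if "K \<in> set (map zero_set ls)" for K
      using that ls(2) by (auto simp: is_line_def)
    show "A \<notin> K" if "K \<in> set (map zero_set ls)" for K
      using that zero[of A] fundamental_poly(2)[OF X A] by (metis UnionI zero_neq_one)
  qed (simp add: ls)
  then show "\<exists>ls. line_cover n X A ls" by blast
next
  assume *: "poised n X \<and> (\<forall>A\<in>X. \<exists>ls. line_cover n X A ls)"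
  show "GC_nat n X" unfolding GC_nat_def
  proof (intro conjI ballI)
    fix A assume A: "A \<in> X"
    then obtain ls where ls: "line_cover n X A ls" using * by blast
    obtain c where c: "c \<noteq> 0" "fundamental_poly n X A = smult [:c:] (lines_poly ls)"
      using line_cover_fundamental[OF _ A ls] * by blast
    show "\<exists>ls. length ls = n \<and> (\<forall>l\<in>set ls. deg_one l) \<and> fundamental_poly n X A = prod_list ls"
    proof (cases ls)
      \<comment> \<open>Without factors nothing can absorb \<open>c\<close>, but evaluation at
        \<open>A\<close> shows \<open>c = 1\<close>.\<close>
      case Nil
      then have "fundamental_poly n X A = smult [:c:] 1" using c(2) by (simp add: lines_poly_def)
      moreover from this have "c = 1"
        using fundamental_poly(2)[of n X A] * A by (metis eval2_1 eval2_smult mult.right_neutral)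
      ultimately show ?thesis using Nil ls
        by (intro exI[of _ "[]"]) (auto simp: line_cover_def one_pCons)
    next
      case (Cons K Ks)
      then show ?thesis using ls c
        by (intro exI[of _ "smult [:c:] (line_poly K) # map line_poly Ks"])
          (auto simp: line_cover_def lines_poly_def line_poly deg_one_smult)
    qed
  qed (use * in blast)
qed (auto simp: GC_nat_def)

lemma GC_nat_finite: "GC_nat n X \<Longrightarrow> finite X"
  by (simp add: GC_nat_def poised_def)

lemma GC_nat_cover: "GC_nat n X \<Longrightarrow> A \<in> X \<Longrightarrow> \<exists>ls. line_cover n X A ls"
  by (simp add: GC_nat_iff)

text \<open>If a degree-one polynomial divides the product of the cover, its zero set lies in the
  union of the cover and is therefore one of its lines. So any cover of \<open>A\<close> may be
  consulted.\<close>

lemma uses_line_iff: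
  assumes "GC_nat n X" "A \<in> X" "line_cover n X A ls"
  shows "uses_line n X A L \<longleftrightarrow> L \<in> set ls"
proof -
  have X: "poised n X" using assms(1) by (simp add: GC_nat_def)
  have ls: "\<forall>K\<in>set ls. is_line K" "length ls = n" using assms(3) by (auto simp: line_cover_def)
  obtain c where c: "c \<noteq> 0" "fundamental_poly n X A = smult [:c:] (lines_poly ls)"
    using line_cover_fundamental[OF X assms(2,3)] by blast
  show ?thesis
  proof
    assume "uses_line n X A L"
    then obtain l q where lq: "deg_one l" "zero_set l = L" "fundamental_poly n X A = l * q"
      by (auto simp: uses_line_def)
    have "L \<subseteq> \<Union>(set ls)"
    proof
      fix P assume "P \<in> L"
      then have "eval2 (smult [:c:] (lines_poly ls)) P = 0"
        using lq by (auto simp: zero_set_def simp flip: c(2))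
      then show "P \<in> \<Union>(set ls)" using c(1) eval2_lines_poly[OF ls(1)] by simp
    qed
    moreover have "is_line L" using lq by (auto simp: is_line_def)
    ultimately show "L \<in> set ls" using line_in_cover ls by blast
  next
    assume L: "L \<in> set ls"
    have "lines_poly (remove1 L ls) \<in> bipolys (n - 1)"
      using lines_poly_bipolys[of "remove1 L ls"] ls L set_remove1_subset[of L ls]
      by (auto simp: length_remove1)
    then have "smult [:c:] (lines_poly (remove1 L ls)) \<in> bipolys (n - 1)" by (rule bipolys_smult)
    moreover have "fundamental_poly n X A = line_poly L * smult [:c:] (lines_poly (remove1 L ls))"
      using c(2) lines_poly_remove1[OF L] by simp
    ultimately show "uses_line n X A L"
      unfolding uses_line_def using line_poly[of L] ls(1) L by blast
  qed
qed

section \<open>Maximal lines as factors, and their removal\<close>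

lemma maximal_line_iff: "maximal_line n X M \<longleftrightarrow> is_line M \<and> card (X \<inter> M) = n + 1"
  by (simp add: maximal_line_def node_line_def)

lemma maximal_in_cover:
  assumes "line_cover n X A ls" "maximal_line n X M" "A \<notin> M" shows "M \<in> set ls"
proof (rule ccontr)
  assume "M \<notin> set ls"
  then have "card (X \<inter> M) \<le> length ls"
    using assms by (intro card_cover_le[of ls M]) (auto simp: line_cover_def maximal_line_iff)
  then show False using assms by (simp add: line_cover_def maximal_line_iff)
qed

lemma line_cover_remove1:
  assumes "line_cover n X A ls" "K \<in> set ls" shows "line_cover (n - 1) (X - K) A (remove1 K ls)"
proof -
  have "P \<in> \<Union>(set (remove1 K ls))" if "P \<in> X" "P \<noteq> A" "P \<notin> K" for P
  proof -
    obtain K' where "K' \<in> set ls" "P \<in> K'" using \<open>P \<in> X\<close> \<open>P \<noteq> A\<close> assms(1) by (auto simp: line_cover_def)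
    moreover from this have "K' \<in> set (remove1 K ls)"
      using \<open>P \<notin> K\<close> in_set_remove1[of K' K ls] by metis
    ultimately show ?thesis by blast
  qed
  then show ?thesis
    using assms set_remove1_subset[of K ls] unfolding line_cover_def
    by (auto simp: length_remove1)
qed

text \<open>A polynomial of degree at most \<open>n + 1\<close> that vanishes at the
  \<open>n + 2\<close> nodes of \<open>M\<close> is divisible by the equation of \<open>M\<close>,
  which reduces interpolation on \<open>X - M\<close> to interpolation on \<open>X\<close>. The
  cover of a node off \<open>M\<close> contains \<open>M\<close>, which is removed from it.\<close>

lemma GC_nat_Diff_maximal:
  assumes "GC_nat (Suc n) X" "maximal_line (Suc n) X M" shows "GC_nat n (X - M)"
  unfolding GC_nat_iff
proof (intro conjI ballI)
  have X: "poised (Suc n) X" using assms(1) by (simp add: GC_nat_def)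
  have M: "is_line M" "card (X \<inter> M) = n + 2" using assms(2) by (auto simp: maximal_line_iff)
  let ?m = "line_poly M"
  show "poised n (X - M)" unfolding poised_def
  proof (intro conjI allI)
    show "finite (X - M)" using X by (simp add: poised_def)
    fix c :: "point \<Rightarrow> real"
    \<comment> \<open>The data are multiplied by the equation of \<open>M\<close> beforehand, so
      that the quotient takes the values \<open>c\<close>.\<close>
    obtain p where p: "p \<in> bipolys (Suc n)"
        "\<And>A. A \<in> X \<Longrightarrow> eval2 p A = (if A \<in> M then 0 else eval2 ?m A * c A)"
      using X[unfolded poised_def, THEN conjunct2, rule_format,
          of "\<lambda>A. if A \<in> M then 0 else eval2 ?m A * c A"] by blast
    have "\<exists>q\<in>bipolys (Suc n - 1). p = ?m * q"
      using M p by (intro line_divides[of _ _ _ "X \<inter> M"]) (auto simp: line_poly)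
    then obtain q where q: "q \<in> bipolys n" "p = ?m * q" by auto
    have "eval2 q A = c A" if "A \<in> X - M" for A
      using that p(2)[of A] eval2_line_poly[OF M(1), of A] q(2) by auto
    moreover have "q' = q" if q': "q' \<in> bipolys n" "\<forall>A\<in>X - M. eval2 q' A = c A" for q'
    proof -
      have "?m * (q' - q) = 0"
      proof (rule poised_eq_0[OF X])
        show "?m * (q' - q) \<in> bipolys (Suc n)"
          using bipolys_mult[of ?m 1 "q' - q" n] q(1) q'(1) deg_one_bipolys[OF line_poly(1)[OF M(1)]]
          by (simp add: bipolys_diff)
        show "eval2 (?m * (q' - q)) A = 0" if "A \<in> X" for A
          using that q'(2) calculation[of A] eval2_line_poly[OF M(1), of A] by (cases "A \<in> M") auto
      qed
      moreover have "?m \<noteq> 0" using line_poly(1)[OF M(1)] bipolys_zero by (auto simp: deg_one_def)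
      ultimately show ?thesis by simp
    qed
    ultimately show "\<exists>!p. p \<in> bipolys n \<and> (\<forall>A\<in>X - M. eval2 p A = c A)"
      using q(1) by blast
  qed
  fix A assume A: "A \<in> X - M"
  then obtain ls where "line_cover (Suc n) X A ls" using GC_nat_cover assms(1) by blast
  then show "\<exists>ls. line_cover n (X - M) A ls"
    using line_cover_remove1 maximal_in_cover assms(2) A
    by (metis Diff_iff diff_Suc_1)
qed

section \<open>Maximal lines and users\<close>

text \<open>The cover of a node \<open>B\<close> of \<open>L\<close> does not contain
  \<open>L\<close>, so its \<open>n\<close> lines reach at most \<open>n\<close> further nodes of
  \<open>L\<close>.\<close>

lemma card_line_le:
  assumes "GC_nat n X" "is_line L" shows "card (X \<inter> L) \<le> n + 1"
proof (rule ccontr)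
  assume neg: "\<not> ?thesis"
  then have "X \<inter> L \<noteq> {}" by auto
  then obtain B where B: "B \<in> X" "B \<in> L" by blast
  obtain ls where ls: "line_cover n X B ls" using GC_nat_cover assms(1) B(1) by blast
  have "card (X \<inter> L - {B}) \<le> length ls"
    using ls assms(2) B by (intro card_cover_le[of _ L]) (auto simp: line_cover_def)
  then show False using neg B ls by (simp add: line_cover_def)
qed

text \<open>Without a common node, \<open>M'\<close> would keep all its \<open>n + 1\<close> nodes
  in \<open>X - M\<close>, one more than a line can have in degree \<open>n - 1\<close>.\<close>

lemma maximal_lines_meet:
  assumes "GC_nat n X" "1 \<le> n" "maximal_line n X M" "maximal_line n X M'" "M \<noteq> M'"
  shows "\<exists>P\<in>X. M \<inter> M' = {P}"
proof -
  obtain m where n: "n = Suc m" using assms(2) by (cases n) auto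
  have "X \<inter> M \<inter> M' \<noteq> {}"
  proof
    assume "X \<inter> M \<inter> M' = {}"
    then have "(X - M) \<inter> M' = X \<inter> M'" by blast
    then have "card ((X - M) \<inter> M') = m + 2" using assms(4) n by (simp add: maximal_line_iff)
    moreover have "GC_nat m (X - M)" using GC_nat_Diff_maximal assms n by blast
    ultimately show False using card_line_le[of m "X - M" M'] assms(4) by (simp add: maximal_line_iff)
  qed
  then obtain P where "P \<in> X" "P \<in> M" "P \<in> M'" by blast
  moreover have "M \<inter> M' \<subseteq> {P}"
    using line_eqI[of M M' P] assms(3-5) calculation by (auto simp: maximal_line_iff)
  ultimately show ?thesis by blast
qed

lemma maximal_line_Diff:
  assumes "GC_nat n X" "1 \<le> n" "maximal_line n X M" "maximal_line n X M'" "M \<noteq> M'"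
  shows "maximal_line (n - 1) (X - M) M'"
proof -
  obtain P where P: "P \<in> X" "M \<inter> M' = {P}" using maximal_lines_meet[OF assms] by blast
  then have "(X - M) \<inter> M' = X \<inter> M' - {P}" by blast
  moreover have "P \<in> X \<inter> M'" using P by blast
  ultimately show ?thesis using assms(2,4) by (simp add: maximal_line_iff)
qed

lemma GC_nat_Diff:
  "GC_nat n X \<Longrightarrow> 1 \<le> n \<Longrightarrow> maximal_line n X M \<Longrightarrow> GC_nat (n - 1) (X - M)"
  using GC_nat_Diff_maximal[of "n - 1" X M] by simp

lemma GC_nat_0D: assumes "GC_nat 0 X" shows "\<exists>P. X = {P}"
proof -
  have "X \<noteq> {}"
  proof
    assume "X = {}"
    moreover have "poised 0 X" using assms by (simp add: GC_nat_def)
    ultimately show False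
      using poised_eq_0[of 0 X 1] bipolys_one by auto
  qed
  then obtain P where P: "P \<in> X" by blast
  then obtain ls where "line_cover 0 X P ls" using GC_nat_cover assms by blast
  then have "X = {P}" using P by (auto simp: line_cover_def)
  then show ?thesis by blast
qed

text \<open>Once \<open>M1\<close> is removed, \<open>M2\<close> and \<open>M3\<close> are still
  maximal and share a node off \<open>M1\<close>. Together with \<open>P\<close> on all three lines
  this would give them two common points.\<close>

lemma maximal_lines_not_concurrent:
  assumes "GC_nat n X" "1 \<le> n"
    and "maximal_line n X M1" "maximal_line n X M2" "maximal_line n X M3"
    and "M1 \<noteq> M2" "M1 \<noteq> M3" "M2 \<noteq> M3" "P \<in> M1" "P \<in> M2"
  shows "P \<notin> M3"
proof
  assume P: "P \<in> M3"
  have max: "maximal_line (n - 1) (X - M1) M2" "maximal_line (n - 1) (X - M1) M3"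
    using maximal_line_Diff assms by blast+
  have GC: "GC_nat (n - 1) (X - M1)" using GC_nat_Diff assms by blast
  obtain Q where "Q \<in> X - M1" "Q \<in> M2" "Q \<in> M3"
  proof (cases "n = 1")
    \<comment> \<open>Degree 0 is outside the range of \<open>maximal_lines_meet\<close>, but the
      single remaining node lies on both lines.\<close>
    case True
    then obtain Q where Q: "X - M1 = {Q}" using GC_nat_0D[of "X - M1"] GC by (metis diff_self_eq_0)
    have "card ({Q} \<inter> M2) \<noteq> 0" "card ({Q} \<inter> M3) \<noteq> 0"
      using max unfolding Q by (auto simp: maximal_line_iff)
    then show ?thesis using that[of Q] Q by auto
  next
    case False
    then have "1 \<le> n - 1" using assms(2) by simp
    then obtain Q where "Q \<in> X - M1" "M2 \<inter> M3 = {Q}"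
      using maximal_lines_meet[OF GC _ max assms(8)] by blast
    then show ?thesis using that by blast
  qed
  then show False
    using line_eqI[of M2 M3 P Q] P assms by (auto simp: maximal_line_iff)
qed

text \<open>\<open>K\<close> has \<open>n\<close> nodes off \<open>M\<close> and at most one on
  \<open>M\<close>; that further node would make it maximal in \<open>X\<close>.\<close>

lemma maximal_line_lift:
  assumes "finite X" "1 \<le> n" "maximal_line (n - 1) (X - M) K" "is_line M" "\<not> maximal_line n X K"
  shows "K \<inter> M \<inter> X = {}" "card (X \<inter> K) = n" "is_line K"
proof -
  have c: "card ((X - M) \<inter> K) = n" and K: "is_line K" using assms(2,3) by (auto simp: maximal_line_iff)
  have "K \<noteq> M"
  proof
    assume "K = M"
    then have "(X - M) \<inter> K = {}" by blast
    then show False using c assms(2) by simp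
  qed
  have split: "card (X \<inter> K) = n + card (X \<inter> K \<inter> M)"
  proof -
    have "X \<inter> K = ((X - M) \<inter> K) \<union> (X \<inter> K \<inter> M)" by blast
    moreover have "card (((X - M) \<inter> K) \<union> (X \<inter> K \<inter> M)) = card ((X - M) \<inter> K) + card (X \<inter> K \<inter> M)"
      using assms(1) by (intro card_Un_disjoint) auto
    ultimately show ?thesis using c by simp
  qed
  moreover have "card (X \<inter> K \<inter> M) \<le> 1" using card_inter_lines K assms(4) \<open>K \<noteq> M\<close> by blast
  moreover have "card (X \<inter> K) \<noteq> n + 1" using K assms(5) by (auto simp: maximal_line_iff)
  ultimately have "card (X \<inter> K \<inter> M) = 0" by linarith
  then show "K \<inter> M \<inter> X = {}" using assms(1) by auto
  show "card (X \<inter> K) = n" using split \<open>card (X \<inter> K \<inter> M) = 0\<close> by simp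
  show "is_line K" by (rule K)
qed

text \<open>The \<open>n\<close> nodes of \<open>M\<close> other than \<open>B\<close> need all
  \<open>n\<close> lines of the cover, so none of these lines can miss them.\<close>

lemma cover_avoids_disjoint_line:
  assumes "line_cover n X B ls" "maximal_line n X M" "B \<in> X" "B \<in> M" "K \<inter> M \<inter> X = {}"
  shows "K \<notin> set ls"
proof
  assume K: "K \<in> set ls"
  let ?S = "X \<inter> M - {B}"
  have cov: "line_cover (n - 1) (X - K) B (remove1 K ls)" using line_cover_remove1 assms(1) K by blast
  have "card ?S \<le> length (remove1 K ls)"
    using cov assms by (intro card_cover_le[of _ M]) (auto simp: line_cover_def maximal_line_iff)
  moreover have "card ?S = n" using assms by (simp add: maximal_line_iff)
  moreover have "0 < length ls" using K by (cases ls) auto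
  moreover have "length (remove1 K ls) = n - 1" "length ls = n"
    using cov assms(1) by (simp_all only: line_cover_def)
  ultimately show False by linarith
qed

section \<open>Nodes using a line in the two configurations\<close>

lemma users_eq:
  assumes "GC_nat n X"
  shows "users n X L = {A \<in> X. \<exists>ls. line_cover n X A ls \<and> L \<in> set ls}"
  unfolding users_def using uses_line_iff[OF assms] GC_nat_cover[OF assms] by blast

text \<open>A node off \<open>M\<close> has \<open>M\<close> among its factors, and the rest of its
  cover serves as a cover in \<open>X - M\<close>.\<close>

lemma users_Diff_maximal:
  assumes "GC_nat n X" "1 \<le> n" "maximal_line n X M" "L \<noteq> M"
  shows "users (n - 1) (X - M) L = users n X L - M"
proof -
  have "uses_line (n - 1) (X - M) A L \<longleftrightarrow> uses_line n X A L" if A: "A \<in> X - M" for A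
  proof -
    obtain ls where ls: "line_cover n X A ls" using GC_nat_cover assms(1) A by blast
    have M: "M \<in> set ls" using maximal_in_cover ls assms(3) A by blast
    have "uses_line n X A L \<longleftrightarrow> L \<in> set ls" using uses_line_iff ls assms(1) A by blast
    moreover have "uses_line (n - 1) (X - M) A L \<longleftrightarrow> L \<in> set (remove1 M ls)"
      using uses_line_iff[OF GC_nat_Diff A] line_cover_remove1[OF ls M] assms by blast
    ultimately show ?thesis using assms(4) by (simp add: in_set_remove1)
  qed
  then show ?thesis by (auto simp: users_def)
qed

text \<open>A node of \<open>M\<close> has only factors that meet \<open>M\<close> in nodes, so it
  cannot use \<open>L\<close>. A node off both lines has the factor \<open>M\<close>, which takes no
  node of \<open>L\<close>; the other \<open>n - 1\<close> factors cover the \<open>n\<close> nodes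
  of \<open>L\<close> only if \<open>L\<close> is one of them.\<close>

lemma users_of_line_missing_maximal:
  assumes GC: "GC_nat n X" and L: "node_line n X L" and M: "maximal_line n X M" "M \<inter> L \<inter> X = {}"
  shows "users n X L = X - (L \<union> M)"
proof (intro equalityI subsetI)
  fix A assume "A \<in> users n X L"
  then obtain ls where A: "A \<in> X" "line_cover n X A ls" "L \<in> set ls" using users_eq[OF GC] by blast
  then have "A \<notin> L" by (auto simp: line_cover_def)
  moreover have "A \<notin> M" using cover_avoids_disjoint_line[of n X A ls M L] A M by blast
  ultimately show "A \<in> X - (L \<union> M)" using A by blast
next
  fix A assume A: "A \<in> X - (L \<union> M)"
  then obtain ls where ls: "line_cover n X A ls" using GC_nat_cover GC by blast
  have Mls: "M \<in> set ls" using maximal_in_cover ls M A by blast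
  have cov: "line_cover (n - 1) (X - M) A (remove1 M ls)" by (rule line_cover_remove1[OF ls Mls])
  have "L \<in> set (remove1 M ls)"
  proof (rule ccontr)
    assume "L \<notin> set (remove1 M ls)"
    then have "card (X \<inter> L) \<le> length (remove1 M ls)"
      using cov L M A by (intro card_cover_le[of _ L]) (auto simp: line_cover_def node_line_def)
    moreover have "0 < length ls" using Mls by (cases ls) auto
    moreover have "length (remove1 M ls) = n - 1" "length ls = n" "card (X \<inter> L) = n"
      using cov ls L by (simp_all only: line_cover_def node_line_def)
    ultimately show False by linarith
  qed
  then have "L \<in> set ls" using set_remove1_subset[of M ls] by blast
  then show "A \<in> users n X L" using users_eq[OF GC] ls A by blast
qed

text \<open>If \<open>A\<close> were on \<open>M\<close>, then \<open>M'\<close> would also be a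
  factor. But \<open>L\<close> and \<open>M'\<close> meet \<open>M\<close> only in \<open>P\<close>,
  so the remaining \<open>n - 2\<close> factors would have to cover \<open>n - 1\<close> nodes of
  \<open>M\<close>.\<close>

lemma user_of_line_notin_maximal:
  assumes A: "A \<in> X" "line_cover n X A ls" "L \<in> set ls"
    and L: "node_line n X L" and M: "maximal_line n X M" "maximal_line n X M'" "M \<inter> M' = {P}" "P \<in> X" "P \<in> L"
  shows "A \<notin> M"
proof
  assume AM: "A \<in> M"
  have "A \<notin> L" using A by (auto simp: line_cover_def)
  then have "A \<noteq> P" "A \<notin> M'" using M AM by auto
  then have M': "M' \<in> set ls" using maximal_in_cover A M by blast
  have "L \<noteq> M'" "L \<noteq> M" using L M(1,2) by (auto simp: node_line_def maximal_line_iff)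
  define ls' where "ls' = remove1 L (remove1 M' ls)"
  have L': "L \<in> set (remove1 M' ls)" using A(3) \<open>L \<noteq> M'\<close> by (simp add: in_set_remove1)
  have cov: "line_cover (n - 1 - 1) (X - M' - L) A ls'"
    unfolding ls'_def by (intro line_cover_remove1 A M' L')
  have disj: "Q \<notin> L" "Q \<notin> M'" if "Q \<in> M" "Q \<noteq> P" for Q
    using that M L \<open>L \<noteq> M\<close> line_eqI[of L M P Q] by (auto simp: maximal_line_iff node_line_def)
  have "card (X \<inter> M - {A, P}) \<le> length ls'"
    using cov disj M AM by (intro card_cover_le[of _ M]) (auto simp: line_cover_def maximal_line_iff)
  moreover have "card (X \<inter> M - {A, P}) = n - 1"
    using M A AM \<open>A \<noteq> P\<close> by (subst card_Diff_subset) (auto simp: maximal_line_iff)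
  moreover have "2 \<le> n"
    using length_pos_if_in_set[OF L'] A(2) M' by (auto simp: line_cover_def length_remove1)
  ultimately show False using cov by (simp add: line_cover_def)
qed

text \<open>For a node off the three lines, \<open>M\<close> and \<open>M'\<close> are factors that
  meet \<open>L\<close> only in \<open>P\<close>. The other \<open>n - 2\<close> factors cannot
  cover the remaining \<open>n - 1\<close> nodes of \<open>L\<close> unless \<open>L\<close> is
  among them.\<close>

lemma users_of_line_through_vertex:
  assumes GC: "GC_nat n X" and L: "node_line n X L"
    and M: "maximal_line n X M" "maximal_line n X M'" "M \<noteq> M'" "M \<inter> M' = {P}" "P \<in> X" "P \<in> L"
  shows "users n X L = X - (L \<union> M \<union> M')"
proof (intro equalityI subsetI)
  fix A assume "A \<in> users n X L"
  then obtain ls where A: "A \<in> X" "line_cover n X A ls" "L \<in> set ls" using users_eq[OF GC] by blast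
  then have "A \<notin> L" by (auto simp: line_cover_def)
  moreover have "A \<notin> M" using user_of_line_notin_maximal[OF A L M(1,2,4-6)] .
  moreover have "A \<notin> M'"
    using user_of_line_notin_maximal[OF A L M(2,1) _ M(5,6)] M(4) by blast
  ultimately show "A \<in> X - (L \<union> M \<union> M')" using A by blast
next
  fix A assume A: "A \<in> X - (L \<union> M \<union> M')"
  then obtain ls where ls: "line_cover n X A ls" using GC_nat_cover GC by blast
  have "M \<in> set ls" "M' \<in> set ls" using maximal_in_cover ls M A by blast+
  then have M': "M' \<in> set (remove1 M ls)" using M(3) by (simp add: in_set_remove1)
  define ls' where "ls' = remove1 M' (remove1 M ls)"
  have cov: "line_cover (n - 1 - 1) (X - M - M') A ls'"
    unfolding ls'_def by (intro line_cover_remove1 ls M' \<open>M \<in> set ls\<close>)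
  have "L \<noteq> M" "L \<noteq> M'" using L M(1,2) by (auto simp: node_line_def maximal_line_iff)
  then have disj: "Q \<notin> M" "Q \<notin> M'" if "Q \<in> L" "Q \<noteq> P" for Q
    using that M(1,2,4,6) L line_eqI[of L M P Q] line_eqI[of L M' P Q]
    unfolding maximal_line_iff node_line_def by blast+
  have "L \<in> set ls'"
  proof (rule ccontr)
    assume "L \<notin> set ls'"
    then have "card (X \<inter> L - {P}) \<le> length ls'"
      using cov disj L A by (intro card_cover_le[of _ L]) (auto simp: line_cover_def node_line_def)
    moreover have "card (X \<inter> L - {P}) = n - 1" using M L by (simp add: node_line_def)
    moreover have "2 \<le> n"
      using length_pos_if_in_set[OF M'] ls \<open>M \<in> set ls\<close> by (auto simp: line_cover_def length_remove1)
    ultimately show False using cov by (simp add: line_cover_def)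
  qed
  then have "L \<in> set ls" unfolding ls'_def
    using set_remove1_subset[of M' "remove1 M ls"] set_remove1_subset[of M ls] by blast
  then show "A \<in> users n X L" using users_eq[OF GC] ls A by blast
qed

lemma isCont_eval2:
  "isCont f t \<Longrightarrow> isCont g t \<Longrightarrow> isCont (\<lambda>t. eval2 p (f t, g t)) t"
proof (induction p)
  case (pCons a p)
  then show ?case by (simp add: eval2_pCons isCont_o2[OF _ poly_isCont])
qed simp

section \<open>Existence of three maximal lines\<close>

text \<open>
  Let \<open>f\<close> be the product of the lines of \<open>ls\<close> with the factor \<open>K = CT\<close> replaced by the line \<open>CB\<close>,
  and \<open>g\<close> the product of the lines of \<open>ls'\<close>. Up to a scalar, \<open>f\<close> and \<open>g\<close> agree on \<open>M\<close>, \<open>K1\<close> and \<open>K2\<close>,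
  so they differ by a multiple of \<open>M K1 K2\<close>, which has a double zero at \<open>C\<close>. Hence the factor of \<open>g\<close>
  through \<open>C\<close> has the same direction as \<open>CB\<close>.
\<close>

lemma cover_lines_involution:
  assumes n: "2 \<le> n" and M: "maximal_line n X M"
    and K1: "is_line K1" "card (X \<inter> K1) = n" "K1 \<inter> M \<inter> X = {}"
    and K2: "is_line K2" "card (X \<inter> K2) = n" "K2 \<inter> M \<inter> X = {}"
    and K12: "K1 \<noteq> K2" and C: "C \<in> X" "C \<in> K1" "C \<in> K2"
    and B: "B \<in> X" "B \<in> M" "line_cover n X B ls" "K \<in> set ls" "C \<in> K"
    and T: "T \<in> X" "T \<in> M" "T \<in> K" "line_cover n X T ls'" "K' \<in> set ls'" "C \<in> K'"
  shows "B \<in> K'"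
proof -
  have "C \<notin> M" using C K1 by blast
  have lines: "\<forall>K\<in>set ls. is_line K" "\<forall>K\<in>set ls'. is_line K" and len: "length ls = n" "length ls' = n"
    and lM: "is_line M" "card (X \<inter> M) = n + 1"
    using B(3)[unfolded line_cover_def] T(4)[unfolded line_cover_def] M[unfolded maximal_line_iff]
    by simp_all
  have BT: "B \<noteq> T" "B \<noteq> C" "T \<noteq> C" using B T \<open>C \<notin> M\<close> unfolding line_cover_def by blast+
  have notin: "K1 \<notin> set ls" "K2 \<notin> set ls" "K1 \<notin> set ls'" "K2 \<notin> set ls'" "M \<notin> set ls" "M \<notin> set ls'"
    using cover_avoids_disjoint_line[OF B(3) M B(1,2)] cover_avoids_disjoint_line[OF T(4) M T(1,2)]
      K1(3) K2(3) B(2,3) T(2,4) by (simp_all only: line_cover_def) blast+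
  define q where "q = lines_poly (remove1 K ls)"
  define q' where "q' = lines_poly (remove1 K' ls')"
  define j where "j = line_poly (join C B)"
  define m k1 k2 where "m = line_poly M" and "k1 = line_poly K1" and "k2 = line_poly K2"
  note polys = q_def q'_def j_def m_def k1_def k2_def
  have lines1: "\<forall>K\<in>set (remove1 K ls). is_line K" "\<forall>K\<in>set (remove1 K' ls'). is_line K"
    using lines set_remove1_subset[of K ls] set_remove1_subset[of K' ls'] by blast+
  have J: "is_line (join C B)" using is_line_join BT by auto
  have q_bi: "q \<in> bipolys (n - 1)"
    using lines_poly_bipolys[OF lines1(1)] B(4) len by (simp add: q_def length_remove1)
  have p': "lines_poly ls' = line_poly K' * q'"
    unfolding q'_def using lines_poly_remove1 T(5) by blast
  have p'_bi: "lines_poly ls' \<in> bipolys n" using lines_poly_bipolys[OF lines(2)] len by simp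
  have r_bi: "j * q \<in> bipolys n"
    using bipolys_mult[of j 1 q "n - 1"] q_bi deg_one_bipolys[OF line_poly(1)[OF J]] n by (simp add: j_def)
  have q0: "eval2 q N = 0" if N: "N \<in> X" "N \<noteq> B" "N \<notin> K" for N
  proof -
    obtain H where "H \<in> set ls" "N \<in> H" using line_coverD(4)[OF B(3) N(1,2)] by blast
    then have "H \<in> set (remove1 K ls)" using N(3) in_set_remove1[of H K ls] by metis
    then show ?thesis using eval2_lines_poly[OF lines1(1), of N] \<open>N \<in> H\<close> by (auto simp: q_def)
  qed
  have p'0: "eval2 (lines_poly ls') N = 0" if "N \<in> X" "N \<noteq> T" for N
    using that eval2_lines_poly[OF lines(2)] T(4) by (auto simp: line_cover_def)
  have j0: "eval2 j N = 0 \<longleftrightarrow> N \<in> join C B" for N using eval2_line_poly[OF J] by (simp add: j_def)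
  have p'T: "eval2 (lines_poly ls') T \<noteq> 0"
    using eval2_lines_poly[OF lines(2)] T(4) by (auto simp: line_cover_def)
  \<comment> \<open>\<open>c\<close> makes the two products agree at \<open>T\<close>, so that
    \<open>s\<close> vanishes there as at the other nodes of \<open>M\<close>.\<close>
  define c where "c = eval2 (j * q) T / eval2 (lines_poly ls') T"
  \<comment> \<open>The line \<open>CB\<close> meets \<open>M\<close> only in \<open>B\<close>, and
    by tightness on \<open>M\<close> no entry of \<open>ls\<close> other than \<open>K\<close>
    passes through \<open>T\<close>.\<close>
  have "c \<noteq> 0"
  proof -
    have "T \<notin> join C B"
      using line_eqI[OF J lM(1), of B T] BT B T \<open>C \<notin> M\<close> by (metis join_mem)
    moreover have "eval2 q T \<noteq> 0"
    proof
      assume "eval2 q T = 0"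
      then obtain H where "H \<in> set (remove1 K ls)" "T \<in> H"
        using eval2_lines_poly[OF lines1(1)] by (auto simp: q_def)
      moreover have "X \<inter> M - {B} \<subseteq> \<Union>(set ls)" using B(3) by (auto simp: line_cover_def)
      moreover have "length ls \<le> card (X \<inter> M - {B})" using B lM len by simp
      ultimately show False
        using tight_cover_unique[of ls M "X \<inter> M - {B}" K T H] lines lM notin B T BT by auto
    qed
    ultimately show ?thesis using p'T j0 by (simp add: c_def)
  qed
  define s where "s = j * q - smult [:c:] (lines_poly ls')"
  have s_bi: "s \<in> bipolys n" unfolding s_def by (intro bipolys_diff bipolys_smult r_bi p'_bi)
  have onM: "eval2 s N = 0" if N: "N \<in> X" "N \<in> M" for N
  proof (cases "N = T")
    case True then show ?thesis using p'T by (simp add: s_def c_def)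
  next
    case False
    have "eval2 (j * q) N = 0"
    proof (cases "N = B")
      case True then show ?thesis using j0 by simp
    next
      case NB: False
      have "N \<notin> K"
        using line_eqI[of K M N T] lines B(4) lM N T(2,3) False notin(5) by metis
      then show ?thesis using q0 N NB by simp
    qed
    then show ?thesis using p'0 N False by (simp add: s_def)
  qed
  have onKi: "eval2 s N = 0"
    if N: "N \<in> X" "N \<in> L" and L: "is_line L" "L \<inter> M \<inter> X = {}" "L \<notin> set ls" "C \<in> L" for N L
  proof -
    have "N \<noteq> B" "N \<noteq> T" using N L B T by auto
    have "eval2 (j * q) N = 0"
    proof (cases "N = C")
      case True then show ?thesis using j0 by simp
    next
      case False
      have "N \<notin> K" using line_eqI[of K L N C] lines B(4,5) L N False by metis
      then show ?thesis using q0 N \<open>N \<noteq> B\<close> by simp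
    qed
    then show ?thesis using p'0 N \<open>N \<noteq> T\<close> by (simp add: s_def)
  qed
  have m0: "eval2 m N = 0 \<longleftrightarrow> N \<in> M" "eval2 k1 N = 0 \<longleftrightarrow> N \<in> K1" "eval2 k2 N = 0 \<longleftrightarrow> N \<in> K2" for N
    using eval2_line_poly lM K1 K2 by (auto simp: m_def k1_def k2_def)
  have dm: "deg_one m" "deg_one k1" "deg_one k2"
    "zero_set m = M" "zero_set k1 = K1" "zero_set k2 = K2"
    using line_poly lM K1 K2 by (auto simp: m_def k1_def k2_def)
  \<comment> \<open>The equations of \<open>M\<close>, \<open>K1\<close> and \<open>K2\<close> are
    split off in turn. On \<open>K2\<close> the node \<open>C\<close> is lost because
    \<open>K1\<close> passes through it, but \<open>n - 1\<close> nodes suffice in degree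
    \<open>n - 2\<close>.\<close>
  obtain s1 where s1: "s1 \<in> bipolys (n - 1)" "s = m * s1"
    using line_divides[OF dm(1) s_bi, of "X \<inter> M"] onM dm lM by auto
  have "eval2 s1 N = 0" if "N \<in> X \<inter> K1" for N
    using onKi[of N K1] that K1 C notin m0(1)[of N] s1(2) by auto
  then obtain s2 where s2: "s2 \<in> bipolys (n - 1 - 1)" "s1 = k1 * s2"
    using line_divides[OF dm(2) s1(1), of "X \<inter> K1"] dm K1 n by auto
  have "eval2 s2 N = 0" if N: "N \<in> X \<inter> K2 - {C}" for N
  proof -
    have "N \<notin> K1" using line_eqI[of K1 K2 N C] N C K1 K2 K12 by blast
    then show ?thesis
      using onKi[of N K2] N K2 C notin m0[of N] s1(2) s2(2) by auto
  qed
  moreover have "n - 1 - 1 < card (X \<inter> K2 - {C})" using C K2 n by simp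
  ultimately obtain s3 where s3: "s2 = k2 * s3"
    using line_divides[OF dm(3) s2(1), of "X \<inter> K2 - {C}"] dm by blast
  have id: "j * q = smult [:c:] (line_poly K' * q') + m * (k1 * (k2 * s3))"
    using s1(2) s2(2) s3 unfolding s_def p' by (metis add.commute diff_add_cancel)
  \<comment> \<open>A parametrisation of the line \<open>CB\<close> with \<open>z 0 = C\<close> and
    \<open>z 1 = B\<close>.\<close>
  define z where "z t = (fst C + t * (fst B - fst C), snd C + t * (snd B - snd C))" for t
  have affine: "eval2 l (z t) = t * eval2 l B" if "deg_one l" "eval2 l C = 0" for l t
    unfolding z_def using deg_one_affine[OF that(1)] that(2) by simp
  have dK': "deg_one (line_poly K')" "eval2 (line_poly K') C = 0" "eval2 (line_poly K') B = 0 \<longleftrightarrow> B \<in> K'"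
    using T lines(2) line_poly eval2_line_poly by auto
  define b b1 b2 where "b = eval2 (line_poly K') B" and "b1 = eval2 k1 B" and "b2 = eval2 k2 B"
  \<comment> \<open>The identity \<open>id\<close> along \<open>CB\<close> with one factor
    \<open>t\<close> cancelled. Both \<open>k1\<close> and \<open>k2\<close> vanish at
    \<open>C\<close>, so the last summand still contains \<open>t\<close> and drops out at
    \<open>t = 0\<close>.\<close>
  define h where "h t = c * (b * eval2 q' (z t)) + eval2 m (z t) * (b1 * (t * b2 * eval2 s3 (z t)))" for t
  have th: "t * h t = 0" for t
  proof -
    have "eval2 j (z t) = 0"
      using affine[of j t] line_poly(1)[OF J] j0 by (simp add: j_def)
    then have "0 = eval2 (j * q) (z t)" by simp
    also have "\<dots> = c * (t * b * eval2 q' (z t)) + eval2 m (z t) * (t * b1 * (t * b2 * eval2 s3 (z t)))"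
      unfolding id using affine[OF dK'(1,2)] affine[of k1] affine[of k2] dm m0 C
      by (simp add: b_def b1_def b2_def)
    also have "\<dots> = t * h t" by (simp add: h_def algebra_simps)
    finally show ?thesis by simp
  qed
  \<comment> \<open>Cancelling \<open>t\<close> is possible only for nonzero \<open>t\<close>;
    continuity supplies the value at 0.\<close>
  have "isCont h 0"
    unfolding h_def z_def by (intro continuous_intros isCont_eval2)
  then have "(h \<longlongrightarrow> h 0) (at 0)" by (simp add: isCont_def)
  moreover have "(h \<longlongrightarrow> 0) (at 0)"
    using th by (intro tendsto_eventually) (auto simp: eventually_at_filter intro: always_eventually)
  ultimately have "h 0 = 0" by (rule LIM_unique)
  moreover have "z 0 = C" by (simp add: z_def)
  ultimately have "b * eval2 q' C = 0" using \<open>c \<noteq> 0\<close> by (simp add: h_def)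
  \<comment> \<open>By tightness on \<open>K1\<close>, only one entry of \<open>ls'\<close> passes
    through \<open>C\<close>.\<close>
  moreover have "eval2 q' C \<noteq> 0"
  proof
    assume "eval2 q' C = 0"
    then obtain H where "H \<in> set (remove1 K' ls')" "C \<in> H"
      using eval2_lines_poly[OF lines1(2)] by (auto simp: q'_def)
    moreover have "X \<inter> K1 \<subseteq> \<Union>(set ls')"
      using T K1(3) by (auto simp: line_cover_def)
    ultimately show False
      using tight_cover_unique[of ls' K1 "X \<inter> K1" K' C H] lines K1 notin C T len by auto
  qed
  ultimately show ?thesis using dK'(3) by (simp add: b_def)
qed

text \<open>\<open>cover_lines_involution\<close> applies at the common node \<open>C\<close> of
  \<open>K1\<close> and \<open>K2\<close>. If \<open>K3\<close> is maximal in \<open>X\<close>, its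
  node on \<open>M\<close> would lie on two factors of its partner. Otherwise the lines through
  \<open>C\<close> would map the \<open>n + 1\<close> nodes of \<open>M\<close> injectively to the
  \<open>n\<close> nodes of \<open>K3\<close>.\<close>

lemma two_nonmaximal_lines:
  assumes GC: "GC_nat n X" and n: "2 \<le> n" and M: "maximal_line n X M"
    and K: "maximal_line (n - 1) (X - M) K1" "maximal_line (n - 1) (X - M) K2" "maximal_line (n - 1) (X - M) K3"
    and distinct: "K1 \<noteq> K2" "K1 \<noteq> K3" "K2 \<noteq> K3"
    and nonmax: "\<not> maximal_line n X K1" "\<not> maximal_line n X K2"
  shows False
proof -
  have fin: "finite X" using GC GC_nat_finite by blast
  have GCY: "GC_nat (n - 1) (X - M)" and n1: "1 \<le> n" "1 \<le> n - 1" using GC_nat_Diff GC M n by auto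
  have lM: "is_line M" "card (X \<inter> M) = n + 1" using M by (auto simp: maximal_line_iff)
  note K1 = maximal_line_lift[OF fin n1(1) K(1) lM(1) nonmax(1)]
  note K2 = maximal_line_lift[OF fin n1(1) K(2) lM(1) nonmax(2)]
  obtain C where C: "C \<in> X - M" "K1 \<inter> K2 = {C}"
    using maximal_lines_meet[OF GCY n1(2) K(1,2) distinct(1)] by blast
  have CK3: "C \<notin> K3"
    using maximal_lines_not_concurrent[OF GCY n1(2) K distinct, of C] C by blast
  obtain cv where cv: "\<And>B. B \<in> X \<Longrightarrow> line_cover n X B (cv B)" using GC_nat_cover[OF GC] by metis
  have lines: "\<forall>K\<in>set (cv B). is_line K" "length (cv B) = n" if "B \<in> X" for B
    using cv[OF that] by (auto simp: line_cover_def)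
  have M_notin: "M \<notin> set (cv B)" if "B \<in> X" "B \<in> M" for B
    using cv[OF that(1)] that(2) by (auto simp: line_cover_def)
  have line_C: "\<exists>L\<in>set (cv B). C \<in> L" if "B \<in> X" "B \<in> M" for B
    using cv[OF that(1)] that(2) C(1) by (auto simp: line_cover_def)
  have tight: "X \<inter> M - {B} \<subseteq> \<Union>(set (cv B))" "length (cv B) \<le> card (X \<inter> M - {B})" if "B \<in> X" "B \<in> M" for B
    using cv[OF that(1)] that lM by (auto simp: line_cover_def)
  have meet_M: "\<exists>T\<in>X \<inter> M - {B}. T \<in> L" if B: "B \<in> X" "B \<in> M" "L \<in> set (cv B)" for B L
    using tight_cover_meets[of "cv B" M "X \<inter> M - {B}" L] lines[OF B(1)] M_notin[OF B(1,2)] tight[OF B(1,2)] lM B(3) by blast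
  have invol: "B \<in> L'"
    if "B \<in> X" "B \<in> M" "L \<in> set (cv B)" "C \<in> L" "T \<in> X" "T \<in> M" "T \<in> L" "L' \<in> set (cv T)" "C \<in> L'" for B T L L'
    using cover_lines_involution[OF n M K1(3,2,1) K2(3,2,1) distinct(1), of C B "cv B" L T "cv T" L'] C cv that by blast
  show False
  proof (cases "maximal_line n X K3")
    case True
    have "K3 \<noteq> M"
    proof
      assume "K3 = M"
      then have "(X - M) \<inter> K3 = {}" by blast
      then show False using K(3) by (simp add: maximal_line_iff)
    qed
    then obtain D where D: "D \<in> X" "M \<inter> K3 = {D}" using maximal_lines_meet[OF GC n1(1) M True] by blast
    then have DM: "D \<in> M" "D \<in> K3" by auto
    obtain L where L: "L \<in> set (cv D)" "C \<in> L" using line_C D DM by blast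
    obtain T where T: "T \<in> X" "T \<in> M" "T \<noteq> D" "T \<in> L" using meet_M[OF D(1) DM(1) L(1)] by blast
    obtain L' where L': "L' \<in> set (cv T)" "C \<in> L'" using line_C T by blast
    have "D \<in> L'" using invol[OF D(1) DM(1) L T(1,2,4) L'] .
    have "T \<notin> K3" using D T by blast
    then have "K3 \<in> set (cv T)" using maximal_in_cover cv T(1) True by blast
    then have "K3 \<in> set (remove1 L' (cv T))" using L' CK3 in_set_remove1[of K3 L' "cv T"] by metis
    then have "D \<notin> K3"
      using tight_cover_unique[of "cv T" M "X \<inter> M - {T}" L' D K3] lines[OF T(1)] lM M_notin[OF T(1,2)]
        tight[OF T(1,2)] L' \<open>D \<in> L'\<close> D DM T by blast
    then show False using DM by blast
  next
    case False
    note K3 = maximal_line_lift[OF fin n1(1) K(3) lM(1) False]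
    have "\<exists>N. N \<in> X \<inter> K3 \<and> (\<exists>L\<in>set (cv B). C \<in> L \<and> N \<in> L)" if B: "B \<in> X \<inter> M" for B
    proof -
      obtain L where L: "L \<in> set (cv B)" "C \<in> L" using line_C B by blast
      have "X \<inter> K3 \<subseteq> \<Union>(set (cv B))" using cv[of B] B K3(1) by (auto simp: line_cover_def)
      moreover have "K3 \<notin> set (cv B)" using cover_avoids_disjoint_line[OF cv M] B K3(1) by blast
      ultimately show ?thesis
        using tight_cover_meets[of "cv B" K3 "X \<inter> K3" L] lines[of B] B K3 L by auto
    qed
    then obtain N where N: "\<And>B. B \<in> X \<inter> M \<Longrightarrow> N B \<in> X \<inter> K3"
        "\<And>B. B \<in> X \<inter> M \<Longrightarrow> \<exists>L\<in>set (cv B). C \<in> L \<and> N B \<in> L" by metis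
    have "inj_on N (X \<inter> M)"
    proof (rule inj_onI)
      fix B D assume BD: "B \<in> X \<inter> M" "D \<in> X \<inter> M" "N B = N D"
      obtain L where L: "L \<in> set (cv B)" "C \<in> L" "N B \<in> L" using N(2) BD(1) by blast
      obtain L2 where L2: "L2 \<in> set (cv D)" "C \<in> L2" "N D \<in> L2" using N(2) BD(2) by blast
      have "N B \<noteq> C" using N(1)[OF BD(1)] CK3 by auto
      moreover have "is_line L" "is_line L2" using lines L L2 BD by blast+
      ultimately have "L = L2" using line_eqI[of L L2 C "N B"] L L2 BD(3) by metis
      \<comment> \<open>The line through \<open>C\<close> and the common image meets
        \<open>M\<close> in \<open>T\<close>. The involution puts both \<open>B\<close> and
        \<open>D\<close> on the factor of \<open>T\<close> through \<open>C\<close>, which is not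
        \<open>M\<close>.\<close>
      obtain T where T: "T \<in> X" "T \<in> M" "T \<in> L" using meet_M BD(1) L(1) by blast
      obtain L' where L': "L' \<in> set (cv T)" "C \<in> L'" using line_C T by blast
      have "B \<in> L'" "D \<in> L'"
        using invol[OF _ _ L(1,2) T L'] invol[OF _ _ L2(1,2) T(1,2) _ L'] BD T(3) \<open>L = L2\<close> by auto
      moreover have "L' \<noteq> M" "is_line L'" using C L' lines T by auto
      ultimately show "B = D" using line_eqI[of L' M B D] lM BD by blast
    qed
    then have "card (X \<inter> M) \<le> card (X \<inter> K3)"
      using N(1) fin by (intro card_inj_on_le[of N]) auto
    then show False using lM K3 by simp
  qed
qed

lemma GM_conjectureD: "GM_conjecture n \<Longrightarrow> GC_nat n X \<Longrightarrow> \<exists>M. maximal_line n X M"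
  by (simp add: GM_conjecture_def GC_set_def)

text \<open>Maximal lines are removed one after another, so the dimension of
  \<open>bipolys n\<close> need not be computed.\<close>

lemma card_GC_nat:
  assumes "\<And>k. 1 \<le> k \<Longrightarrow> k \<le> n \<Longrightarrow> GM_conjecture k" "GC_nat n X"
  shows "card X = (n + 2) choose 2"
  using assms
proof (induction n arbitrary: X)
  case 0
  then show ?case using GC_nat_0D[of X] by (auto simp: numeral_2_eq_2)
next
  case (Suc n)
  obtain M where M: "maximal_line (Suc n) X M" using GM_conjectureD Suc.prems by force
  have "card (X - M) = (n + 2) choose 2"
    using Suc.IH[of "X - M"] Suc.prems GC_nat_Diff_maximal[OF _ M] by simp
  moreover have "card X = card (X - M) + card (X \<inter> M)"
    using card_Int_Diff[of X M] GC_nat_finite[OF Suc.prems(2)] by simp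
  ultimately show ?case using M by (simp add: maximal_line_iff numeral_2_eq_2)
qed

text \<open>Of three maximal lines of \<open>X - M\<close> at most one fails to be maximal in
  \<open>X\<close>, by \<open>two_nonmaximal_lines\<close>; the other two are added to
  \<open>M\<close>. In degree 1 the lines are the sides of a triangle.\<close>

lemma three_maximal_lines:
  assumes "1 \<le> n" "\<And>k. 1 \<le> k \<Longrightarrow> k \<le> n \<Longrightarrow> GM_conjecture k" "GC_nat n X"
  shows "\<exists>M1 M2 M3. maximal_line n X M1 \<and> maximal_line n X M2 \<and> maximal_line n X M3 \<and>
    M1 \<noteq> M2 \<and> M1 \<noteq> M3 \<and> M2 \<noteq> M3"
  using assms
proof (induction n arbitrary: X rule: nat_induct_at_least)
  case base
  obtain M where M: "maximal_line 1 X M" using GM_conjectureD base by blast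
  have fin: "finite X" using base GC_nat_finite by blast
  have lM: "is_line M" "card (X \<inter> M) = 2" using M by (auto simp: maximal_line_iff)
  then obtain A B where AB: "X \<inter> M = {A, B}" "A \<noteq> B" by (meson card_2_iff)
  obtain Q where Q: "X - M = {Q}" 
    using GC_nat_0D[of "X - M"] GC_nat_Diff_maximal[of 0 X M] base(2) M by (metis One_nat_def)
  then have QX: "Q \<in> X" "Q \<notin> M" "X = {A, B, Q}" using AB by auto
  have AQ: "A \<noteq> Q" "B \<noteq> Q" "A \<in> M" "B \<in> M" using AB QX by auto
  have l: "is_line (join A Q)" "is_line (join B Q)" using is_line_join AQ by auto
  have ne: "B \<notin> join A Q" "A \<notin> join B Q"
    using line_eqI[OF l(1) lM(1), of A B] line_eqI[OF l(2) lM(1), of A B] AQ AB QX by (metis join_mem)+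
  have "X \<inter> join A Q = {A, Q}" "X \<inter> join B Q = {B, Q}" unfolding QX(3) using ne by auto
  then have "maximal_line 1 X (join A Q)" "maximal_line 1 X (join B Q)"
    using l AQ by (auto simp: maximal_line_iff)
  moreover have "M \<noteq> join A Q" "M \<noteq> join B Q" "join A Q \<noteq> join B Q"
    using QX ne by (metis join_mem)+
  ultimately show ?case using M by blast
next
  case (Suc n)
  obtain M where M: "maximal_line (Suc n) X M" using GM_conjectureD Suc.prems by force
  have GCY: "GC_nat n (X - M)" using GC_nat_Diff_maximal Suc.prems M by blast
  obtain K1 K2 K3 where K: "maximal_line n (X - M) K1" "maximal_line n (X - M) K2" "maximal_line n (X - M) K3"
      and d: "K1 \<noteq> K2" "K1 \<noteq> K3" "K2 \<noteq> K3"
    using Suc.IH[OF _ GCY] Suc.prems(1) by auto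
  have neM: "K \<noteq> M" if "maximal_line n (X - M) K" for K
  proof
    assume "K = M"
    then have "(X - M) \<inter> K = {}" by blast
    then show False using that by (simp add: maximal_line_iff)
  qed
  have two: False if "maximal_line n (X - M) L1" "maximal_line n (X - M) L2" "maximal_line n (X - M) L3"
      "L1 \<noteq> L2" "L1 \<noteq> L3" "L2 \<noteq> L3" "\<not> maximal_line (Suc n) X L1" "\<not> maximal_line (Suc n) X L2" for L1 L2 L3
    using two_nonmaximal_lines[OF Suc.prems(2) _ M, of L1 L2 L3] that Suc.hyps by simp
  have "(maximal_line (Suc n) X K1 \<or> maximal_line (Suc n) X K2) \<and>
     (maximal_line (Suc n) X K1 \<or> maximal_line (Suc n) X K3) \<and>
     (maximal_line (Suc n) X K2 \<or> maximal_line (Suc n) X K3)"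
    using two[OF K(1,2,3)] two[OF K(1,3,2)] two[OF K(2,3,1)] d by metis
  then show ?case using M neM K d by metis
qed

section \<open>Lines with \<open>n\<close> nodes\<close>

text \<open>The first disjunct is the configuration of (i), the second that of (ii).\<close>

definition missed_or_vertex :: "nat \<Rightarrow> point set \<Rightarrow> point set \<Rightarrow> bool" where
  "missed_or_vertex n X L \<longleftrightarrow>
     (\<exists>M. maximal_line n X M \<and> M \<inter> L \<inter> X = {}) \<or>
     (\<exists>M M' P. maximal_line n X M \<and> maximal_line n X M' \<and> M \<noteq> M' \<and> P \<in> X \<and> M \<inter> M' = {P} \<and> P \<in> L)"

text \<open>If \<open>K\<close> were not maximal in \<open>X\<close>, it would share no node with
  \<open>M'\<close>. But \<open>K\<close> and \<open>M'\<close> are both maximal in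
  \<open>X - M\<close> and so meet in a node.\<close>

lemma maximal_line_of_two_Diffs:
  assumes GC: "GC_nat n X" "2 \<le> n" and M: "maximal_line n X M" "maximal_line n X M'" "M \<noteq> M'"
    and K: "maximal_line (n - 1) (X - M) K" "maximal_line (n - 1) (X - M') K" "K \<noteq> M'"
  shows "maximal_line n X K"
proof (rule ccontr)
  assume neg: "\<not> maximal_line n X K"
  have "K \<inter> M' \<inter> X = {}"
    using maximal_line_lift(1)[OF GC_nat_finite[OF GC(1)] _ K(2) _ neg] GC(2) M(2) by (auto simp: maximal_line_iff)
  moreover have "maximal_line (n - 1) (X - M) M'" "GC_nat (n - 1) (X - M)"
    using maximal_line_Diff GC_nat_Diff GC M by auto
  then obtain P where "P \<in> X - M" "K \<inter> M' = {P}"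
    using maximal_lines_meet[OF _ _ K(1) _ K(3)] GC(2) by fastforce
  ultimately show False by blast
qed

lemma maximal_line_avoiding:
  assumes "maximal_line n X K1" "maximal_line n X K2" "maximal_line n X K3"
    and "K1 \<noteq> K2" "K1 \<noteq> K3" "K2 \<noteq> K3"
  shows "\<exists>K. maximal_line n X K \<and> K \<noteq> M \<and> K \<noteq> M'"
  using assms by metis

context
  fixes n :: nat and X L :: "point set"
  assumes GC: "GC_nat n X" and n: "1 \<le> n" and L: "node_line n X L"
    and bad: "\<not> missed_or_vertex n X L"
begin

lemma maximal_neq_L: "maximal_line n X M \<Longrightarrow> M \<noteq> L"
  using L by (auto simp: maximal_line_iff node_line_def)

lemma maximal_meets_L: "maximal_line n X M \<Longrightarrow> \<exists>P\<in>X. M \<inter> L = {P}"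
proof -
  assume M: "maximal_line n X M"
  then have "M \<inter> L \<inter> X \<noteq> {}" using bad unfolding missed_or_vertex_def by metis
  then obtain P where P: "P \<in> X" "P \<in> M" "P \<in> L" by blast
  have lines: "is_line M" "is_line L" using M L by (auto simp: maximal_line_iff node_line_def)
  have "Q = P" if "Q \<in> M" "Q \<in> L" for Q
    using line_eqI[OF lines P(2) that(1) P(3) that(2)] maximal_neq_L[OF M] by metis
  then have "M \<inter> L = {P}" using P by blast
  then show ?thesis using P(1) by blast
qed

lemma maximal_lines_disjoint_on_L:
  "maximal_line n X M \<Longrightarrow> maximal_line n X M' \<Longrightarrow> M \<noteq> M' \<Longrightarrow> P \<in> L \<Longrightarrow> P \<in> M \<Longrightarrow> P \<notin> M'"
  using maximal_lines_meet[OF GC n, of M M'] bad unfolding missed_or_vertex_def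
  by (metis IntI singletonD)

text \<open>Since (i) fails, \<open>M\<close> takes exactly one node from \<open>L\<close>. The
  induction can therefore pass to \<open>X - M\<close> with the same line.\<close>

lemma node_line_Diff:
  assumes M: "maximal_line n X M" shows "node_line (n - 1) (X - M) L"
proof -
  obtain P where P: "P \<in> X" "M \<inter> L = {P}" using maximal_meets_L[OF M] by blast
  then have "(X - M) \<inter> L = X \<inter> L - {P}" "P \<in> X \<inter> L" by blast+
  then show ?thesis using L n by (simp add: node_line_def)
qed

text \<open>
  The lines \<open>K\<close>, \<open>K'\<close> are those of the configuration (i) or (ii) for \<open>X - M\<close>, without \<open>M'\<close>; they coincide if
  only one line is left.
\<close>

lemma nonusers_covered:
  assumes M: "maximal_line n X M" "maximal_line n X M'" "M \<noteq> M'"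
    and mv: "missed_or_vertex (n - 1) (X - M) L"
  shows "\<exists>K K'. (\<forall>H\<in>{K, K'}. maximal_line (n - 1) (X - M) H \<and> H \<noteq> M') \<and>
    X - (L \<union> M \<union> M') - users n X L = (X - (L \<union> M \<union> M')) \<inter> (K \<union> K') \<and>
    \<not> (maximal_line n X K \<and> maximal_line n X K')"
proof -
  have GCY: "GC_nat (n - 1) (X - M)" using GC_nat_Diff GC n M(1) .
  have LY: "node_line (n - 1) (X - M) L" using node_line_Diff M(1) .
  have U: "users (n - 1) (X - M) L = users n X L - M"
    using users_Diff_maximal[OF GC n M(1)] maximal_neq_L[OF M(1)] by metis
  from mv[unfolded missed_or_vertex_def] show ?thesis
  proof (elim disjE exE conjE)
    \<comment> \<open>Every maximal line of \<open>X\<close> other than \<open>M\<close> meets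
      \<open>L\<close> in a node off \<open>M\<close>, so \<open>K\<close> is neither
      \<open>M'\<close> nor maximal in \<open>X\<close>.\<close>
    fix K assume K: "maximal_line (n - 1) (X - M) K" "K \<inter> L \<inter> (X - M) = {}"
    have "K \<noteq> M'"
    proof
      assume "K = M'"
      obtain P where "P \<in> X" "M' \<inter> L = {P}" using maximal_meets_L[OF M(2)] by blast
      moreover from this have "P \<notin> M" using maximal_lines_disjoint_on_L[OF M(2,1)] M(3) by blast
      ultimately show False using K(2) \<open>K = M'\<close> by blast
    qed
    moreover have "users n X L - M = X - M - (L \<union> K)"
      using users_of_line_missing_maximal[OF GCY LY K] U by simp
    then have "X - (L \<union> M \<union> M') - users n X L = (X - (L \<union> M \<union> M')) \<inter> (K \<union> K)" by blast
    moreover have "\<not> maximal_line n X K"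
    proof
      assume max: "maximal_line n X K"
      have "K \<noteq> M"
      proof
        assume "K = M"
        then have "(X - M) \<inter> K = {}" by blast
        then show False using K(1) by (simp add: maximal_line_iff)
      qed
      obtain P where "P \<in> X" "K \<inter> L = {P}" using maximal_meets_L[OF max] by blast
      moreover from this have "P \<notin> M" using maximal_lines_disjoint_on_L[OF max M(1) \<open>K \<noteq> M\<close>] by blast
      ultimately show False using K(2) by blast
    qed
    ultimately show ?thesis using K(1) by blast
  next
    fix K K' P
    assume K: "maximal_line (n - 1) (X - M) K" "maximal_line (n - 1) (X - M) K'" "K \<noteq> K'"
      "P \<in> X - M" "K \<inter> K' = {P}" "P \<in> L"
    have eq: "users n X L - M = X - M - (L \<union> K \<union> K')"
      using users_of_line_through_vertex[OF GCY LY K(1,2,3,5,4,6)] U by simp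
    \<comment> \<open>If both lines were maximal in \<open>X\<close>, then \<open>P\<close> would
      give configuration (ii) there.\<close>
    have nonmax: "\<not> (maximal_line n X K \<and> maximal_line n X K')"
      using bad K(3-6) unfolding missed_or_vertex_def by blast
    consider "K = M'" | "K' = M'" | "K \<noteq> M'" "K' \<noteq> M'" by blast
    then show ?thesis
    proof cases
      case 1
      then have "X - (L \<union> M \<union> M') - users n X L = (X - (L \<union> M \<union> M')) \<inter> (K' \<union> K')" using eq by blast
      then show ?thesis using 1 K nonmax M(2) by blast
    next
      case 2
      then have "X - (L \<union> M \<union> M') - users n X L = (X - (L \<union> M \<union> M')) \<inter> (K \<union> K)" using eq by blast
      then show ?thesis using 2 K nonmax M(2) by blast
    next
      case 3
      have "X - (L \<union> M \<union> M') - users n X L = (X - (L \<union> M \<union> M')) \<inter> (K \<union> K')" using eq by blast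
      then show ?thesis using 3 K nonmax by blast
    qed
  qed
qed

text \<open>Otherwise \<open>K\<close> would meet each of \<open>L\<close>, \<open>M'\<close>,
  \<open>H\<close>, \<open>H'\<close> in at most one node. These lines contain all \<open>n\<close>
  nodes of \<open>K\<close> off \<open>M\<close>, so \<open>n\<close> would be at most 4.\<close>

lemma covered_line_is_covering:
  assumes n5: "5 \<le> n" and M: "maximal_line n X M" "is_line M'"
    and K: "maximal_line (n - 1) (X - M) K" "K \<noteq> M'"
    and H: "is_line H" "is_line H'" "(X - (L \<union> M \<union> M')) \<inter> K \<subseteq> H \<union> H'"
  shows "K = H \<or> K = H'"
proof (rule ccontr)
  assume neg: "\<not> (K = H \<or> K = H')"
  have fin: "finite X" using GC GC_nat_finite by blast
  have lK: "is_line K" "card ((X - M) \<inter> K) = n" using K(1) n by (auto simp: maximal_line_iff)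
  have lL: "is_line L" "card ((X - M) \<inter> L) = n - 1" using node_line_Diff[OF M(1)] by (auto simp: node_line_def)
  have "K \<noteq> L" using lK lL n by auto
  have "(X - M) \<inter> K \<subseteq> (X \<inter> K \<inter> L) \<union> (X \<inter> K \<inter> M') \<union> (X \<inter> K \<inter> H) \<union> (X \<inter> K \<inter> H')" (is "_ \<subseteq> ?R")
    using H(3) by blast
  then have "n \<le> card ?R" using card_mono[of ?R] fin lK(2) by auto
  also have "card ?R \<le> card (X \<inter> K \<inter> L) + card (X \<inter> K \<inter> M') + card (X \<inter> K \<inter> H) + card (X \<inter> K \<inter> H')"
    by (meson add_mono card_Un_le le_trans order_refl)
  also have "\<dots> \<le> 1 + 1 + 1 + 1"
    using neg lK(1) lL(1) M(2) K(2) H(1,2) \<open>K \<noteq> L\<close> by (intro add_mono card_inter_lines) auto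
  finally show False using n5 by simp
qed

lemma bad_degree_ge_5:
  assumes n5: "5 \<le> n" and M: "maximal_line n X M" "maximal_line n X M'" "M \<noteq> M'"
    and mv: "missed_or_vertex (n - 1) (X - M) L" "missed_or_vertex (n - 1) (X - M') L"
  shows False
proof -
  let ?T = "X - (L \<union> M \<union> M')"
  obtain K K' where K: "\<forall>H\<in>{K, K'}. maximal_line (n - 1) (X - M) H \<and> H \<noteq> M'"
      "?T - users n X L = ?T \<inter> (K \<union> K')" "\<not> (maximal_line n X K \<and> maximal_line n X K')"
    using nonusers_covered[OF M mv(1)] by blast
  obtain H H' where H: "\<forall>K\<in>{H, H'}. maximal_line (n - 1) (X - M') K \<and> K \<noteq> M"
      "?T - users n X L = ?T \<inter> (H \<union> H')"
    using nonusers_covered[OF M(2,1) M(3)[symmetric] mv(2)]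
    unfolding Un_assoc Un_commute[of M' M] by blast
  have lines: "is_line H" "is_line H'" "is_line M'" using H(1) M by (auto simp: maximal_line_iff)
  have "?T \<inter> (K \<union> K') \<subseteq> H \<union> H'" using K(2) H(2) by blast
  then have sub: "?T \<inter> K \<subseteq> H \<union> H'" "?T \<inter> K' \<subseteq> H \<union> H'" by blast+
  have max: "maximal_line (n - 1) (X - M) K" "K \<noteq> M'" "maximal_line (n - 1) (X - M) K'" "K' \<noteq> M'"
    using K(1) by simp_all
  have "K = H \<or> K = H'" "K' = H \<or> K' = H'"
    using covered_line_is_covering[OF n5 M(1) lines(3) max(1,2) lines(1,2) sub(1)]
      covered_line_is_covering[OF n5 M(1) lines(3) max(3,4) lines(1,2) sub(2)] .
  then have "maximal_line (n - 1) (X - M') K" "maximal_line (n - 1) (X - M') K'"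
    using H(1) by blast+
  moreover have "2 \<le> n" using n5 by simp
  ultimately have "maximal_line n X K" "maximal_line n X K'"
    using maximal_line_of_two_Diffs[OF GC _ M] K(1) by blast+
  then show False using K(3) by blast
qed

end

subsection \<open>Degree 4\<close>

text \<open>Neither of the two lines passes through \<open>A\<close>, so neither contains both
  \<open>E\<close> and \<open>D\<close> or both \<open>E'\<close> and \<open>D'\<close>. Each thus
  takes one point of either pair, and one of them contains \<open>R\<close>.\<close>

lemma two_line_pairing:
  assumes ls: "line_cover 2 Y A ls"
    and M: "is_line M" "is_line M'" "A \<in> M" "A \<in> M'"
    and E: "E \<in> Y" "D \<in> Y" "E \<in> M" "D \<in> M" "E \<noteq> D" "E \<noteq> A" "D \<noteq> A"
    and E': "E' \<in> Y" "D' \<in> Y" "E' \<in> M'" "D' \<in> M'" "E' \<noteq> D'" "E' \<noteq> A" "D' \<noteq> A"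
    and O: "R \<in> Y" "R \<noteq> A"
  shows "\<exists>p. is_line p \<and> R \<in> p \<and>
    ({E, E'} \<subseteq> p \<or> {D, D'} \<subseteq> p \<or> {E, D'} \<subseteq> p \<or> {D, E'} \<subseteq> p)"
proof -
  obtain p q where pq: "ls = [p, q]"
    using ls by (auto simp: line_cover_def length_Suc_conv numeral_2_eq_2)
  have l: "is_line p" "is_line q" "A \<notin> p" "A \<notin> q"
    using line_coverD[OF ls] by (auto simp: pq)
  have cov: "P \<in> p \<or> P \<in> q" if "P \<in> Y" "P \<noteq> A" for P
    using line_coverD(4)[OF ls that] by (auto simp: pq)
  have "\<not> (E \<in> h \<and> D \<in> h)" "\<not> (E' \<in> h \<and> D' \<in> h)" if "is_line h" "A \<notin> h" for h
    using line_eqI[of h M E D] line_eqI[of h M' E' D'] that M E E' by metis+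
  then show ?thesis
    using cov[OF E(1,6)] cov[OF E(2,7)] cov[OF E'(1,6)] cov[OF E'(2,7)] cov[OF O] l
    by (smt (verit) empty_subsetI insert_subset)
qed

text \<open>Applied to the lines joining \<open>R\<close> to the nodes \<open>Ei\<close> and
  \<open>Di\<close>. As the \<open>ei\<close> are distinct, at most one index can need its
  \<open>ei\<close> in place of its \<open>di\<close>.\<close>

lemma pairing_majority:
  assumes "distinct [e1, e2, e3, e4]" "d1 \<noteq> e1" "d2 \<noteq> e2" "d3 \<noteq> e3" "d4 \<noteq> e4"
    and "d1 = d2 \<or> d1 = e2 \<or> e1 = d2" "d1 = d3 \<or> d1 = e3 \<or> e1 = d3" "d1 = d4 \<or> d1 = e4 \<or> e1 = d4"
    and "d2 = d3 \<or> d2 = e3 \<or> e2 = d3" "d2 = d4 \<or> d2 = e4 \<or> e2 = d4" "d3 = d4 \<or> d3 = e4 \<or> e3 = d4"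
  shows "(d1 = d2 \<and> d1 = d3 \<and> d1 = d4) \<or> (e1 = d2 \<and> e1 = d3 \<and> e1 = d4) \<or> (d1 = e2 \<and> d1 = d3 \<and> d1 = d4)
    \<or> (d1 = d2 \<and> d1 = e3 \<and> d1 = d4) \<or> (d1 = d2 \<and> d1 = d3 \<and> d1 = e4)"
  using assms unfolding distinct.simps list.set by (smt (verit) insertCI)

context
  fixes X L :: "point set"
  assumes GC: "GC_nat 4 X" and L: "node_line 4 X L"
    and bad: "\<not> missed_or_vertex 4 X L"
begin

lemma GC_nat_Diff_3: "maximal_line 4 X M \<Longrightarrow> GC_nat 3 (X - M)"
  using GC_nat_Diff[of 4 X M] GC by simp

lemma maximal_line_Diff_3: "maximal_line 4 X M \<Longrightarrow> maximal_line 4 X M' \<Longrightarrow> M \<noteq> M' \<Longrightarrow> maximal_line 3 (X - M) M'"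
  using maximal_line_Diff[of 4 X M M'] GC by simp

lemma GC_nat_Diff_2: assumes "maximal_line 4 X M" "maximal_line 3 (X - M) M'" shows "GC_nat 2 (X - M - M')"
  using GC_nat_Diff[of 3 "X - M" M'] GC_nat_Diff_3 assms by simp

lemma maximal_line_Diff_2:
  "maximal_line 4 X M \<Longrightarrow> maximal_line 3 (X - M) M' \<Longrightarrow> maximal_line 3 (X - M) K \<Longrightarrow> M' \<noteq> K \<Longrightarrow>
    maximal_line 2 (X - M - M') K"
  using maximal_line_Diff[of 3 "X - M" M' K] GC_nat_Diff_3 by simp

lemma GC_nat_Diff_1:
  assumes "maximal_line 4 X M" "maximal_line 3 (X - M) M'" "maximal_line 3 (X - M) M''" "M' \<noteq> M''"
  shows "GC_nat 1 (X - M - M' - M'')"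
  using GC_nat_Diff[of 2 "X - M - M'" M''] GC_nat_Diff_2 maximal_line_Diff_2 assms by simp

lemma maximal_line_Diff_1:
  assumes "maximal_line 4 X M" "maximal_line 3 (X - M) M'" "maximal_line 3 (X - M) M''" "M' \<noteq> M''"
    "maximal_line 3 (X - M) K" "M' \<noteq> K" "M'' \<noteq> K"
  shows "maximal_line 1 (X - M - M' - M'') K"
  using maximal_line_Diff[of 2 "X - M - M'" M'' K] GC_nat_Diff_2 maximal_line_Diff_2 assms by simp

lemmas meets_L = maximal_meets_L[OF GC _ L bad, simplified]
lemmas disjoint_on_L = maximal_lines_disjoint_on_L[OF GC _ L bad, simplified]

lemma cover_residue:
  assumes M: "maximal_line 4 X M" "maximal_line 3 (X - M) K" "A \<in> X" "A \<notin> M" "A \<notin> K"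
  shows "\<exists>ls. line_cover 2 (X - M - K) A ls"
  using GC_nat_cover[OF GC_nat_Diff_2[OF M(1,2)]] assms(3-5) by blast

text \<open>Let \<open>Ei\<close> be the node of \<open>Mi\<close> on \<open>L\<close>,
  \<open>Di\<close> another node of \<open>Mi\<close> off the other three lines, and
  \<open>R\<close> the only node off all four. Pairings seen from \<open>R\<close> produce a line
  through \<open>R\<close> and one node of each pair \<open>Ei\<close>, \<open>Di\<close>. With five
  nodes it is maximal, but it meets \<open>L\<close> in some \<open>Ei\<close>, which already lies
  on \<open>Mi\<close>.\<close>

lemma no_four_maximal_lines:
  assumes M: "maximal_line 4 X M1" "maximal_line 4 X M2" "maximal_line 4 X M3" "maximal_line 4 X M4"
    and d: "distinct [M1, M2, M3, M4]"
  shows False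
proof -
  have fin: "finite X" using GC GC_nat_finite by blast
  \<comment> \<open>After the removal of three lines, \<open>M\<close> keeps two nodes, one of which
    is off \<open>L\<close>.\<close>
  have ex: "\<exists>E D. E \<in> X \<and> D \<in> X \<and> M \<inter> L = {E} \<and> D \<in> M \<and> E \<noteq> D \<and> D \<notin> N1 \<and> D \<notin> N2 \<and> D \<notin> N3"
    if N: "maximal_line 4 X M" "maximal_line 4 X N1" "maximal_line 4 X N2" "maximal_line 4 X N3"
      "distinct [M, N1, N2, N3]" for M N1 N2 N3
  proof -
    have "maximal_line 1 (X - N1 - N2 - N3) M" 
    proof -
      have ne: "N1 \<noteq> N2" "N1 \<noteq> N3" "N2 \<noteq> N3" "N1 \<noteq> M" "N2 \<noteq> M" "N3 \<noteq> M" using N(5) by auto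
      show ?thesis
        using maximal_line_Diff_1[OF N(2) maximal_line_Diff_3[OF N(2,3)] maximal_line_Diff_3[OF N(2,4)] _ maximal_line_Diff_3[OF N(2,1)]] ne by blast
    qed
    then have c: "card ((X - N1 - N2 - N3) \<inter> M) = 2" by (simp add: maximal_line_iff)
    obtain E where E: "E \<in> X" "M \<inter> L = {E}" using meets_L[OF N(1)] by blast
    have "(X - N1 - N2 - N3) \<inter> M - {E} \<noteq> {}"
    proof
      assume "(X - N1 - N2 - N3) \<inter> M - {E} = {}"
      then have "(X - N1 - N2 - N3) \<inter> M \<subseteq> {E}" by blast
      then have "card ((X - N1 - N2 - N3) \<inter> M) \<le> card {E}" by (intro card_mono) auto
      then show False using c by simp
    qed
    then show ?thesis using E by blast
  qed
  have dd: "distinct [M1, M2, M3, M4]" "distinct [M2, M1, M3, M4]"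
      "distinct [M3, M1, M2, M4]" "distinct [M4, M1, M2, M3]" using d by auto
  have dne: "M1 \<noteq> M2" "M1 \<noteq> M3" "M1 \<noteq> M4" "M2 \<noteq> M1" "M2 \<noteq> M3" "M2 \<noteq> M4"
      "M3 \<noteq> M1" "M3 \<noteq> M2" "M3 \<noteq> M4" "M4 \<noteq> M1" "M4 \<noteq> M2" "M4 \<noteq> M3" using d by auto
  obtain E1 D1 where D1: "E1 \<in> X" "D1 \<in> X" "M1 \<inter> L = {E1}" "D1 \<in> M1" "E1 \<noteq> D1" "D1 \<notin> M2" "D1 \<notin> M3" "D1 \<notin> M4"
    using ex[OF M dd(1)] by blast
  obtain E2 D2 where D2: "E2 \<in> X" "D2 \<in> X" "M2 \<inter> L = {E2}" "D2 \<in> M2" "E2 \<noteq> D2" "D2 \<notin> M1" "D2 \<notin> M3" "D2 \<notin> M4"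
    using ex[OF M(2,1,3,4) dd(2)] by blast
  obtain E3 D3 where D3: "E3 \<in> X" "D3 \<in> X" "M3 \<inter> L = {E3}" "D3 \<in> M3" "E3 \<noteq> D3" "D3 \<notin> M1" "D3 \<notin> M2" "D3 \<notin> M4"
    using ex[OF M(3,1,2,4) dd(3)] by blast
  obtain E4 D4 where D4: "E4 \<in> X" "D4 \<in> X" "M4 \<inter> L = {E4}" "D4 \<in> M4" "E4 \<noteq> D4" "D4 \<notin> M1" "D4 \<notin> M2" "D4 \<notin> M3"
    using ex[OF M(4,1,2,3) dd(4)] by blast
  have EL: "E1 \<in> L" "E1 \<in> M1" "E2 \<in> L" "E2 \<in> M2" "E3 \<in> L" "E3 \<in> M3" "E4 \<in> L" "E4 \<in> M4"
    using D1(3) D2(3) D3(3) D4(3) by blast+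
  have En: "E1 \<notin> M2" "E1 \<notin> M3" "E1 \<notin> M4" "E2 \<notin> M1" "E2 \<notin> M3" "E2 \<notin> M4"
      "E3 \<notin> M1" "E3 \<notin> M2" "E3 \<notin> M4" "E4 \<notin> M1" "E4 \<notin> M2" "E4 \<notin> M3"
    using disjoint_on_L[OF M(1,2) dne(1) EL(1,2)] disjoint_on_L[OF M(1,3) dne(2) EL(1,2)]
      disjoint_on_L[OF M(1,4) dne(3) EL(1,2)] disjoint_on_L[OF M(2,1) dne(4) EL(3,4)]
      disjoint_on_L[OF M(2,3) dne(5) EL(3,4)] disjoint_on_L[OF M(2,4) dne(6) EL(3,4)]
      disjoint_on_L[OF M(3,1) dne(7) EL(5,6)] disjoint_on_L[OF M(3,2) dne(8) EL(5,6)]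
      disjoint_on_L[OF M(3,4) dne(9) EL(5,6)] disjoint_on_L[OF M(4,1) dne(10) EL(7,8)]
      disjoint_on_L[OF M(4,2) dne(11) EL(7,8)] disjoint_on_L[OF M(4,3) dne(12) EL(7,8)] .
  have "GC_nat 0 (X - M1 - M2 - M3 - M4)"
    using GC_nat_Diff[of 1 "X - M1 - M2 - M3" M4] GC_nat_Diff_1[of M1 M2 M3] maximal_line_Diff_1[of M1 M2 M3 M4] maximal_line_Diff_3[OF M(1)] M dne by simp
  then obtain R where R: "X - M1 - M2 - M3 - M4 = {R}" using GC_nat_0D by blast
  then have RX: "R \<in> X" "R \<notin> M1" "R \<notin> M2" "R \<notin> M3" "R \<notin> M4" by blast+
  have lL: "is_line L" "card (X \<inter> L) = 4" using L by (auto simp: node_line_def)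
  have En': "E1 \<noteq> E2" "E1 \<noteq> E3" "E1 \<noteq> E4" "E2 \<noteq> E3" "E2 \<noteq> E4" "E3 \<noteq> E4" using En EL by metis+
  have XL: "X \<inter> L = {E1, E2, E3, E4}"
  proof -
    have "card {E1, E2, E3, E4} = 4" using En' by auto
    then show ?thesis
      using card_subset_eq[of "X \<inter> L" "{E1, E2, E3, E4}"] fin lL D1(1) D2(1) D3(1) D4(1) EL by auto
  qed
  have "R \<notin> L"
  proof
    assume "R \<in> L"
    then have "R \<in> {E1, E2, E3, E4}" using RX(1) XL by blast
    then show False using RX EL by (elim insertE emptyE) simp_all
  qed
  have lM: "is_line M1" "is_line M2" "is_line M3" "is_line M4" using M by (auto simp: maximal_line_iff)
  \<comment> \<open>The common node \<open>A\<close> of \<open>N1\<close> and \<open>N2\<close> has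
    a cover of two lines once \<open>N3\<close> and \<open>N4\<close> are removed. The pairing of
    \<open>E\<close> with \<open>E'\<close> is excluded, since it would put \<open>R\<close> on
    \<open>L\<close>.\<close>
  have pair: "join R D = join R D' \<or> join R D = join R E' \<or> join R E = join R D'"
    if N: "maximal_line 4 X N1" "maximal_line 4 X N2" "maximal_line 4 X N3" "maximal_line 4 X N4"
      "distinct [N1, N2, N3, N4]"
      and D: "D \<in> X" "D \<in> N1" "D \<notin> N2" "D \<notin> N3" "D \<notin> N4" "D \<noteq> E"
      and D': "D' \<in> X" "D' \<in> N2" "D' \<notin> N1" "D' \<notin> N3" "D' \<notin> N4" "D' \<noteq> E'"
      and E: "E \<in> X" "E \<in> L" "E \<in> N1" "E \<notin> N2" "E \<notin> N3" "E \<notin> N4"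
      and E': "E' \<in> X" "E' \<in> L" "E' \<in> N2" "E' \<notin> N1" "E' \<notin> N3" "E' \<notin> N4"
      and RN: "R \<notin> N1" "R \<notin> N2" "R \<notin> N3" "R \<notin> N4" for N1 N2 N3 N4 D D' E E'
  proof -
    have ne: "N1 \<noteq> N2" "N1 \<noteq> N3" "N1 \<noteq> N4" "N2 \<noteq> N3" "N2 \<noteq> N4" "N3 \<noteq> N4" using N(5) by auto
    obtain A where A: "A \<in> X" "N1 \<inter> N2 = {A}" using maximal_lines_meet[OF GC _ N(1,2) ne(1)] by auto
    then have AN: "A \<in> N1" "A \<in> N2" by blast+
    have one: "1 \<le> (4::nat)" by simp
    have An: "A \<notin> N3" "A \<notin> N4"
      using maximal_lines_not_concurrent[OF GC one N(1,2,3) ne(1,2,4) AN]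
        maximal_lines_not_concurrent[OF GC one N(1,2,4) ne(1,3,5) AN] .
    have "maximal_line 3 (X - N3) N4" using maximal_line_Diff_3[OF N(3,4) ne(6)] .
    then obtain ls where ls: "line_cover 2 (X - N3 - N4) A ls" using cover_residue N(3) A(1) An by blast
    have "\<exists>p. is_line p \<and> R \<in> p \<and> ({E, E'} \<subseteq> p \<or> {D, D'} \<subseteq> p \<or> {E, D'} \<subseteq> p \<or> {D, E'} \<subseteq> p)"
      by (rule two_line_pairing[OF ls, of N1 N2])
         (use N D D' E E' RN AN RX(1) in \<open>auto simp: maximal_line_iff\<close>)
    then obtain p where p: "is_line p" "R \<in> p"
        "{E, E'} \<subseteq> p \<or> {D, D'} \<subseteq> p \<or> {E, D'} \<subseteq> p \<or> {D, E'} \<subseteq> p" by blast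
    have "E \<noteq> E'" using E(3) E'(4) by blast
    then have "\<not> {E, E'} \<subseteq> p" using line_eqI[OF p(1) lL(1), of E E'] E E' p(2) \<open>R \<notin> L\<close> by auto
    moreover have "p = join R Q" if "Q \<in> p" "Q \<noteq> R" for Q
      using line_eq_join[OF p(1,2) that(1)] that(2) by blast
    moreover have "D \<noteq> R" "D' \<noteq> R" "E \<noteq> R" "E' \<noteq> R" using D D' E E' RN by blast+
    ultimately show ?thesis using p(3) by (metis insert_subset)
  qed
  have neq: "join R P \<noteq> join R Q" if "is_line N" "P \<in> N" "Q \<in> N" "P \<noteq> Q" "R \<notin> N" for P Q N
    using line_eqI[OF is_line_join that(1), of R P P Q] that by (metis join_mem)
  have "(join R D1 = join R D2 \<and> join R D1 = join R D3 \<and> join R D1 = join R D4) \<or>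
    (join R E1 = join R D2 \<and> join R E1 = join R D3 \<and> join R E1 = join R D4) \<or>
    (join R D1 = join R E2 \<and> join R D1 = join R D3 \<and> join R D1 = join R D4) \<or>
    (join R D1 = join R D2 \<and> join R D1 = join R E3 \<and> join R D1 = join R D4) \<or>
    (join R D1 = join R D2 \<and> join R D1 = join R D3 \<and> join R D1 = join R E4)"
  proof (rule pairing_majority)
    show "distinct [join R E1, join R E2, join R E3, join R E4]"
      using neq[OF lL(1)] EL En' \<open>R \<notin> L\<close> by simp
    show "join R D1 \<noteq> join R E1" "join R D2 \<noteq> join R E2" "join R D3 \<noteq> join R E3" "join R D4 \<noteq> join R E4"
      using neq[OF lM(1), of D1 E1] neq[OF lM(2), of D2 E2] neq[OF lM(3), of D3 E3] neq[OF lM(4), of D4 E4]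
        D1 D2 D3 D4 EL RX by auto
    show "join R D1 = join R D2 \<or> join R D1 = join R E2 \<or> join R E1 = join R D2"
      using pair[of M1 M2 M3 M4 D1 E1 D2 E2] M dne D1 D2 EL En RX by simp
    show "join R D1 = join R D3 \<or> join R D1 = join R E3 \<or> join R E1 = join R D3"
      using pair[of M1 M3 M2 M4 D1 E1 D3 E3] M dne D1 D3 EL En RX by simp
    show "join R D1 = join R D4 \<or> join R D1 = join R E4 \<or> join R E1 = join R D4"
      using pair[of M1 M4 M2 M3 D1 E1 D4 E4] M dne D1 D4 EL En RX by simp
    show "join R D2 = join R D3 \<or> join R D2 = join R E3 \<or> join R E2 = join R D3"
      using pair[of M2 M3 M1 M4 D2 E2 D3 E3] M dne D2 D3 EL En RX by simp
    show "join R D2 = join R D4 \<or> join R D2 = join R E4 \<or> join R E2 = join R D4"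
      using pair[of M2 M4 M1 M3 D2 E2 D4 E4] M dne D2 D4 EL En RX by simp
    show "join R D3 = join R D4 \<or> join R D3 = join R E4 \<or> join R E3 = join R D4"
      using pair[of M3 M4 M1 M2 D3 E3 D4 E4] M dne D3 D4 EL En RX by simp
  qed
  then obtain P1 P2 P3 P4 where P: "P1 \<in> {D1, E1}" "P2 \<in> {D2, E2}" "P3 \<in> {D3, E3}" "P4 \<in> {D4, E4}"
      "join R P1 = join R P2" "join R P1 = join R P3" "join R P1 = join R P4" by blast
  have PX: "P1 \<in> X" "P2 \<in> X" "P3 \<in> X" "P4 \<in> X" using P D1 D2 D3 D4 by blast+
  have PM: "P1 \<in> M1" "P2 \<in> M2" "P3 \<in> M3" "P4 \<in> M4"
      "P1 \<notin> M2" "P1 \<notin> M3" "P1 \<notin> M4" "P2 \<notin> M3" "P2 \<notin> M4" "P3 \<notin> M4"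
    using P(1-4) D1 D2 D3 D4 EL En by blast+
  define K where "K = join R P1"
  have "R \<noteq> P1" using PM RX by blast
  then have K: "is_line K" using is_line_join K_def by blast
  have "{R, P1, P2, P3, P4} \<subseteq> X \<inter> K"
    using PX RX join_mem P(5-7) unfolding K_def by (metis Int_iff empty_subsetI insert_subset)
  moreover have "card {R, P1, P2, P3, P4} = 5"
    using PM RX by (subst card_insert_disjoint, simp, metis empty_iff insert_iff)+ simp
  ultimately have "5 \<le> card (X \<inter> K)" using card_mono[of "X \<inter> K" "{R, P1, P2, P3, P4}"] fin by simp
  then have "maximal_line 4 X K" using card_line_le[OF GC K] K by (simp add: maximal_line_iff)
  moreover have "K \<noteq> M1" "K \<noteq> M2" "K \<noteq> M3" "K \<noteq> M4" using RX by (auto simp: K_def)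
  moreover obtain E where E: "E \<in> X" "K \<inter> L = {E}" using meets_L \<open>maximal_line 4 X K\<close> by blast
  then have "E \<in> L" "E \<in> K" by blast+
  moreover have "E \<in> {E1, E2, E3, E4}" using E XL \<open>E \<in> L\<close> by blast
  ultimately show False using disjoint_on_L[of K] M EL by blast
qed

text \<open>
  In the next two lemmas \<open>E4\<close>, \<open>R\<close>, \<open>R'\<close> play the role of the three nodes outside \<open>M1\<close>, \<open>M2\<close>, \<open>M3\<close>,
  and \<open>a\<close>, \<open>u\<close>, \<open>v\<close> are the sides of the triangle they form.
\<close>

lemma no_residual_triangle_aux:
  assumes M: "maximal_line 4 X M1" "maximal_line 4 X M2" "maximal_line 4 X M3"
      "M1 \<noteq> M2" "M1 \<noteq> M3" "M2 \<noteq> M3"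
    and E1: "E1 \<in> X" "E1 \<in> L" "E1 \<in> M1" and E3: "E3 \<in> X" "E3 \<in> L" "E3 \<in> M3"
    and E4: "E4 \<in> L" "E4 \<notin> M1" "E4 \<notin> M2" "E4 \<notin> M3"
    and R: "R \<notin> L" "R \<notin> M1" "R \<notin> M2" "R \<notin> M3"
    and R': "R' \<in> X" "R' \<notin> L" "R' \<notin> M1" "R' \<notin> M2" "R' \<notin> M3"
    and a: "maximal_line 3 (X - M1) a" "R \<in> a" "R' \<in> a" "a \<inter> M1 \<inter> X = {}" "E3 \<notin> a"
    and u: "maximal_line 3 (X - M2) u" "E4 \<in> u" "R \<in> u" "R' \<notin> u"
    and v: "maximal_line 3 (X - M3) v" "E4 \<in> v" "R' \<in> v" "v \<inter> M3 \<inter> X = {}"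
  shows False
proof -
  have one: "1 \<le> (3::nat)" "1 \<le> (4::nat)" by simp_all
  have lines: "is_line M1" "is_line M2" "is_line M3" "is_line a" "is_line u" "is_line v" "is_line L"
    using M(1-3) a(1) u(1) v(1) L by (simp_all add: maximal_line_iff node_line_def)
  have E1n: "E1 \<notin> M2" "E1 \<notin> M3" "E3 \<notin> M1" "E3 \<notin> M2"
    using disjoint_on_L[OF M(1,2,4) E1(2,3)] disjoint_on_L[OF M(1,3,5) E1(2,3)]
      disjoint_on_L[OF M(3,1) M(5)[symmetric] E3(2,3)] disjoint_on_L[OF M(3,2) M(6)[symmetric] E3(2,3)] .
  have uM: "u \<noteq> M1" "u \<noteq> M3" "v \<noteq> M1" "v \<noteq> M2" "a \<noteq> M3" "a \<noteq> M2" using u E4 v a R by blast+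
  \<comment> \<open>Removing \<open>M2\<close> and \<open>u\<close> leaves degree 2, where
    \<open>A\<close> has a cover of two lines. The pairs to be matched are \<open>E1\<close>,
    \<open>J\<close> on \<open>M1\<close> and \<open>E3\<close>, \<open>H\<close> on
    \<open>M3\<close>, with \<open>R'\<close> as the extra node.\<close>
  obtain A where A: "A \<in> X" "M1 \<inter> M3 = {A}" using maximal_lines_meet[OF GC one(2) M(1,3,5)] by auto
  then have AN: "A \<in> M1" "A \<in> M3" by blast+
  have "A \<notin> M2" using maximal_lines_not_concurrent[OF GC one(2) M(1,3,2,5,4) M(6)[symmetric] AN] .
  moreover have "A \<notin> u"
    using maximal_lines_not_concurrent[OF GC_nat_Diff_3[OF M(2)] one(1) maximal_line_Diff_3[OF M(2,1) M(4)[symmetric]] maximal_line_Diff_3[OF M(2,3,6)] u(1)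
        M(5) uM(1)[symmetric] uM(2)[symmetric] AN] .
  ultimately obtain ls where ls: "line_cover 2 (X - M2 - u) A ls"
    using cover_residue[OF M(2) u(1) A(1)] by blast
  obtain J where J: "J \<in> X - M3" "v \<inter> M1 = {J}"
    using maximal_lines_meet[OF GC_nat_Diff_3[OF M(3)] one(1) v(1) maximal_line_Diff_3[OF M(3,1) M(5)[symmetric]] uM(3)] by auto
  then have Jv: "J \<in> v" "J \<in> M1" by blast+
  obtain H where H: "H \<in> X - M1" "a \<inter> M3 = {H}"
    using maximal_lines_meet[OF GC_nat_Diff_3[OF M(1)] one(1) a(1) maximal_line_Diff_3[OF M(1,3,5)] uM(5)] by auto
  then have Ha: "H \<in> a" "H \<in> M3" by blast+
  have "J \<notin> M2"
    using maximal_lines_not_concurrent[OF GC_nat_Diff_3[OF M(3)] one(1) v(1) maximal_line_Diff_3[OF M(3,1) M(5)[symmetric]]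
        maximal_line_Diff_3[OF M(3,2) M(6)[symmetric]] uM(3,4) M(4) Jv] .
  have "H \<notin> M2"
    using maximal_lines_not_concurrent[OF GC_nat_Diff_3[OF M(1)] one(1) a(1) maximal_line_Diff_3[OF M(1,3,5)]
        maximal_line_Diff_3[OF M(1,2,4)] uM(5,6) M(6)[symmetric] Ha] .
  have "J \<noteq> E4" "E1 \<noteq> E4" "E3 \<noteq> E4" "H \<noteq> R" "J \<noteq> R'" "H \<noteq> R'" using Jv Ha E1 E3 E4 R R' by blast+
  have "J \<notin> u" using line_eqI[OF lines(5,6) u(2) _ v(2) Jv(1)] \<open>J \<noteq> E4\<close> v(3) u(4) by blast
  have "H \<notin> u" using line_eqI[OF lines(5,4) u(3) _ a(2) Ha(1)] \<open>H \<noteq> R\<close> a(3) u(4) by blast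
  have nL: "E1 \<notin> u" "E3 \<notin> u" "E1 \<notin> v" "E3 \<notin> v"
    using line_eqI[OF lines(5,7) u(2) _ E4(1) E1(2)] line_eqI[OF lines(5,7) u(2) _ E4(1) E3(2)]
      line_eqI[OF lines(6,7) v(2) _ E4(1) E1(2)] line_eqI[OF lines(6,7) v(2) _ E4(1) E3(2)]
      \<open>E1 \<noteq> E4\<close> \<open>E3 \<noteq> E4\<close> u(3) v(3) R(1) R'(2) by blast+
  have "\<exists>p. is_line p \<and> R' \<in> p \<and>
      ({E1, E3} \<subseteq> p \<or> {J, H} \<subseteq> p \<or> {E1, H} \<subseteq> p \<or> {J, E3} \<subseteq> p)"
  proof (rule two_line_pairing[OF ls lines(1,3) AN])
    show "E1 \<in> X - M2 - u" "E3 \<in> X - M2 - u" "R' \<in> X - M2 - u" "J \<in> X - M2 - u" "H \<in> X - M2 - u"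
      using E1 E3 R' J H E1n nL u(4) \<open>J \<notin> u\<close> \<open>H \<notin> u\<close> \<open>J \<notin> M2\<close> \<open>H \<notin> M2\<close> by blast+
    show "E1 \<noteq> J" "E3 \<noteq> H" using nL Jv a(5) Ha by blast+
    show "E1 \<noteq> A" "J \<noteq> A" "E3 \<noteq> A" "H \<noteq> A" "R' \<noteq> A" using AN E1n J(1) H(1) R' by blast+
  qed (use E1 E3 Jv Ha in blast)+
  then obtain p where p: "is_line p" "R' \<in> p"
      "{E1, E3} \<subseteq> p \<or> {J, H} \<subseteq> p \<or> {E1, H} \<subseteq> p \<or> {J, E3} \<subseteq> p" by blast
  have "E1 \<noteq> E3" using E1n E3 by blast
  from p(3) show False
  proof (elim disjE)
    assume "{E1, E3} \<subseteq> p"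
    then have "p = L" using line_eqI[OF p(1) lines(7), of E1 E3] E1 E3 \<open>E1 \<noteq> E3\<close> by simp
    then show False using p(2) R' by blast
  next
    assume *: "{J, H} \<subseteq> p"
    then have "p = a" using line_eqI[OF p(1) lines(4), of H R'] p(2) a Ha \<open>H \<noteq> R'\<close> by simp
    then show False using * a(4) Jv J(1) by blast
  next
    assume *: "{E1, H} \<subseteq> p"
    then have "p = a" using line_eqI[OF p(1) lines(4), of H R'] p(2) a Ha \<open>H \<noteq> R'\<close> by simp
    then show False using * a(4) E1 by blast
  next
    assume *: "{J, E3} \<subseteq> p"
    then have "p = v" using line_eqI[OF p(1) lines(6), of J R'] p(2) v Jv \<open>J \<noteq> R'\<close> by simp
    then show False using * nL by blast
  qed
qed

lemma no_residual_triangle: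
  assumes M: "maximal_line 4 X M1" "maximal_line 4 X M2" "maximal_line 4 X M3"
      "M1 \<noteq> M2" "M1 \<noteq> M3" "M2 \<noteq> M3"
    and E4: "E4 \<in> L" "E4 \<notin> M1" "E4 \<notin> M2" "E4 \<notin> M3"
    and R: "R \<in> X" "R \<notin> L" "R \<notin> M1" "R \<notin> M2" "R \<notin> M3"
    and R': "R' \<in> X" "R' \<notin> L" "R' \<notin> M1" "R' \<notin> M2" "R' \<notin> M3"
    and a: "maximal_line 3 (X - M1) a" "R \<in> a" "R' \<in> a" "a \<inter> M1 \<inter> X = {}"
    and u: "maximal_line 3 (X - M2) u" "E4 \<in> u" "R \<in> u" "R' \<notin> u" "u \<inter> M2 \<inter> X = {}"
    and v: "maximal_line 3 (X - M3) v" "E4 \<in> v" "R' \<in> v" "R \<notin> v" "v \<inter> M3 \<inter> X = {}"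
  shows False
proof -
  obtain E1 where "E1 \<in> X" "M1 \<inter> L = {E1}" using meets_L[OF M(1)] by auto
  then have E1: "E1 \<in> X" "E1 \<in> L" "E1 \<in> M1" by blast+
  obtain E2 where "E2 \<in> X" "M2 \<inter> L = {E2}" using meets_L[OF M(2)] by auto
  then have E2: "E2 \<in> X" "E2 \<in> L" "E2 \<in> M2" by blast+
  obtain E3 where "E3 \<in> X" "M3 \<inter> L = {E3}" using meets_L[OF M(3)] by auto
  then have E3: "E3 \<in> X" "E3 \<in> L" "E3 \<in> M3" by blast+
  have "E2 \<noteq> E3" using disjoint_on_L[OF M(2,3,6) E2(2,3)] E3 by blast
  have "is_line a" "is_line L" using a(1) L by (simp_all add: maximal_line_iff node_line_def)
  \<comment> \<open>\<open>a\<close> differs from \<open>L\<close> because \<open>R\<close> is off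
    \<open>L\<close>. The two cases are exchanged by swapping \<open>M2\<close>, \<open>u\<close>,
    \<open>R\<close> with \<open>M3\<close>, \<open>v\<close>, \<open>R'\<close>.\<close>
  then have "E2 \<notin> a \<or> E3 \<notin> a"
    using line_eqI[of a L E2 E3] E2 E3 \<open>E2 \<noteq> E3\<close> a(2) R(2) by blast
  then show False
    using no_residual_triangle_aux[OF M E1 E3 E4 R(2-5) R' a _ u(1-4) v(1-3,5)]
      no_residual_triangle_aux[OF M(1,3,2,5,4) M(6)[symmetric] E1 E2 E4(1,2,4,3) R'(2,3,5,4) R(1,2,3,5,4)
        a(1,3,2,4) _ v(1-4) u(1-3,5)] by blast
qed

text \<open>The three nodes off three maximal lines form a triangle with one vertex
  \<open>E4\<close> on \<open>L\<close>. Each \<open>X - Mi\<close> has a side of it as a maximal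
  line, and these sides differ, because a common one would be a fourth maximal line of
  \<open>X\<close>. All six assignments reduce to \<open>no_residual_triangle\<close>.\<close>

lemma bad_degree_4: 
  assumes GM: "\<And>k. 1 \<le> k \<Longrightarrow> k \<le> 4 \<Longrightarrow> GM_conjecture k"
  shows False
proof -
  have fin: "finite X" using GC GC_nat_finite by blast
  obtain M1 M2 M3 where M: "maximal_line 4 X M1" "maximal_line 4 X M2" "maximal_line 4 X M3"
      "M1 \<noteq> M2" "M1 \<noteq> M3" "M2 \<noteq> M3" 
    using three_maximal_lines[of 4 X] GM GC by auto
  note M' = M(4-6)[symmetric]
  obtain E1 where E1': "E1 \<in> X" "M1 \<inter> L = {E1}" using meets_L[OF M(1)] by auto
  then have E1: "E1 \<in> X" "E1 \<in> L" "E1 \<in> M1" by blast+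
  obtain E2 where E2': "E2 \<in> X" "M2 \<inter> L = {E2}" using meets_L[OF M(2)] by auto
  then have E2: "E2 \<in> X" "E2 \<in> L" "E2 \<in> M2" by blast+
  obtain E3 where E3': "E3 \<in> X" "M3 \<inter> L = {E3}" using meets_L[OF M(3)] by auto
  then have E3: "E3 \<in> X" "E3 \<in> L" "E3 \<in> M3" by blast+
  have E_neq: "E1 \<noteq> E2" "E1 \<noteq> E3" "E2 \<noteq> E3"
    using disjoint_on_L[OF M(1,2,4) E1(2,3)] disjoint_on_L[OF M(1,3,5) E1(2,3)]
      disjoint_on_L[OF M(2,3,6) E2(2,3)] E2 E3 by blast+
  have lL: "is_line L" "card (X \<inter> L) = 4" using L by (auto simp: node_line_def)
  have "card (X \<inter> L - {E1, E2, E3}) = 1"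
    using lL E1 E2 E3 E_neq by (subst card_Diff_subset) auto
  then obtain E4 where E4s: "X \<inter> L - {E1, E2, E3} = {E4}" by (auto simp: card_1_singleton_iff)
  then have E4: "E4 \<in> X" "E4 \<in> L" "E4 \<noteq> E1" "E4 \<noteq> E2" "E4 \<noteq> E3" by blast+
  have E4n: "E4 \<notin> M1" "E4 \<notin> M2" "E4 \<notin> M3" using E4 E1'(2) E2'(2) E3'(2) by blast+
  define Z where "Z = X - M1 - M2 - M3"
  have GCZ: "GC_nat 1 Z" unfolding Z_def using GC_nat_Diff_1[OF M(1) maximal_line_Diff_3[OF M(1,2,4)] maximal_line_Diff_3[OF M(1,3,5)] M(6)] .
  then have "card Z = 3" using card_GC_nat[of 1 Z] GM by (simp add: numeral_3_eq_3 numeral_2_eq_2)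
  moreover have "E4 \<in> Z" using E4 E4n by (simp add: Z_def)
  ultimately have "card (Z - {E4}) = 2" by simp
  then obtain R R' where RR: "Z - {E4} = {R, R'}" "R \<noteq> R'" by (meson card_2_iff)
  then have Z: "Z = {E4, R, R'}" using \<open>E4 \<in> Z\<close> by blast
  have RX: "R \<in> X" "R \<notin> M1" "R \<notin> M2" "R \<notin> M3" "R \<noteq> E4"
    and RX': "R' \<in> X" "R' \<notin> M1" "R' \<notin> M2" "R' \<notin> M3" "R' \<noteq> E4"
    using RR(1) unfolding Z_def by blast+
  have RL: "Q \<notin> L" if Q: "Q \<in> X" "Q \<notin> M1" "Q \<notin> M2" "Q \<notin> M3" "Q \<noteq> E4" for Q
  proof
    assume "Q \<in> L"
    moreover have "Q \<noteq> E1" "Q \<noteq> E2" "Q \<noteq> E3" using Q E1 E2 E3 by blast+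
    ultimately have "Q \<in> {E4}" using Q(1) unfolding E4s[symmetric] by blast
    then show False using Q(5) by blast
  qed
  define a u v where "a = join R R'" and "u = join E4 R" and "v = join E4 R'"
  have lines: "is_line a" "is_line u" "is_line v"
    using is_line_join RR(2) RX(5) RX'(5) unfolding a_def u_def v_def by metis+
  have mem: "R \<in> a" "R' \<in> a" "E4 \<in> u" "R \<in> u" "E4 \<in> v" "R' \<in> v"
    by (simp_all add: a_def u_def v_def)
  have noncol: "\<not> Z \<subseteq> K" if "is_line K" for K
  proof
    assume "Z \<subseteq> K"
    then have "Z \<inter> K = Z" by blast
    then show False using card_line_le[OF GCZ that] \<open>card Z = 3\<close> by simp
  qed
  have "R' \<notin> u" "R \<notin> v" "E4 \<notin> a" using noncol lines mem Z by blast+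
  \<comment> \<open>A maximal line of \<open>X - N1\<close> other than \<open>N2\<close> and
    \<open>N3\<close> stays maximal in the degree-1 set \<open>Z\<close>, so it passes through two
    of its three nodes.\<close>
  have side: "\<exists>K\<in>{a, u, v}. maximal_line 3 (X - N1) K"
    if N: "maximal_line 4 X N1" "maximal_line 4 X N2" "maximal_line 4 X N3"
      "N1 \<noteq> N2" "N1 \<noteq> N3" "N2 \<noteq> N3" "X - N1 - N2 - N3 = Z" for N1 N2 N3
  proof -
    have "\<exists>K. maximal_line 3 (X - N1) K \<and> K \<noteq> N2 \<and> K \<noteq> N3"
      using three_maximal_lines[of 3 "X - N1"] GM GC_nat_Diff_3[OF N(1)]
        maximal_line_avoiding[of 3 "X - N1" _ _ _ N2 N3] by fastforce
    then obtain K where K: "maximal_line 3 (X - N1) K" "K \<noteq> N2" "K \<noteq> N3" by blast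
    have "maximal_line 1 Z K"
      using maximal_line_Diff_1[OF N(1) maximal_line_Diff_3[OF N(1,2,4)] maximal_line_Diff_3[OF N(1,3,5)] N(6) K(1) K(2,3)[symmetric]] N(7) by simp
    then have lK: "is_line K" "card (Z \<inter> K) = 2" by (auto simp: maximal_line_iff)
    then obtain P Q where PQ: "Z \<inter> K = {P, Q}" "P \<noteq> Q" by (meson card_2_iff)
    then have "P \<in> Z" "Q \<in> Z" "P \<in> K" "Q \<in> K" by blast+
    then have "(R \<in> K \<and> R' \<in> K) \<or> (E4 \<in> K \<and> R \<in> K) \<or> (E4 \<in> K \<and> R' \<in> K)"
      using PQ(2) unfolding Z by (elim insertE emptyE) simp_all
    then have "K \<in> {a, u, v}"
      using line_eq_join[OF lK(1)] RR(2) RX(5) RX'(5) unfolding a_def u_def v_def by blast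
    then show ?thesis using K(1) by blast
  qed
  have neM: "K \<noteq> M1" "K \<noteq> M2" "K \<noteq> M3" if "K \<in> {a, u, v}" for K
    using that mem RX RX' by blast+
  have nonmax: "\<not> maximal_line 4 X K" if "K \<in> {a, u, v}" for K
    using no_four_maximal_lines[OF M(1-3), of K] M(4-6) neM[OF that] by auto
  have disj: "K \<inter> N \<inter> X = {}" if "K \<in> {a, u, v}" "maximal_line 4 X N" "maximal_line 3 (X - N) K" for K N
    using maximal_line_lift(1)[OF fin, of 4 N K] that nonmax[OF that(1)] by (simp add: maximal_line_iff)
  have two: "\<not> (maximal_line 3 (X - N) K \<and> maximal_line 3 (X - N') K)"
    if "K \<in> {a, u, v}" "maximal_line 4 X N" "maximal_line 4 X N'" "N \<noteq> N'" "K \<noteq> N'" for N N' K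
    using maximal_line_of_two_Diffs[OF GC _ that(2,3,4) _ _ that(5)] nonmax[OF that(1)] by auto
  have auv: "a \<in> {a, u, v}" "u \<in> {a, u, v}" "v \<in> {a, u, v}" by simp_all
  have tri: False
    if "maximal_line 4 X N1" "maximal_line 4 X N2" "maximal_line 4 X N3" "N1 \<noteq> N2" "N1 \<noteq> N3" "N2 \<noteq> N3"
      "E4 \<notin> N1" "E4 \<notin> N2" "E4 \<notin> N3" "R \<notin> N1" "R \<notin> N2" "R \<notin> N3" "R' \<notin> N1" "R' \<notin> N2" "R' \<notin> N3"
      "maximal_line 3 (X - N1) a" "maximal_line 3 (X - N2) u" "maximal_line 3 (X - N3) v" for N1 N2 N3
    using no_residual_triangle[OF that(1-6) E4(2) that(7-9) RX(1) RL[OF RX] that(10-12) RX'(1) RL[OF RX'] that(13-15)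
      that(16) mem(1,2) disj[OF auv(1) that(1,16)] that(17) mem(3,4) \<open>R' \<notin> u\<close> disj[OF auv(2) that(2,17)]
      that(18) mem(5,6) \<open>R \<notin> v\<close> disj[OF auv(3) that(3,18)]] .
  have "X - M2 - M1 - M3 = Z" "X - M3 - M1 - M2 = Z" by (auto simp: Z_def)
  then obtain K1 K2 K3 where K: "K1 \<in> {a, u, v}" "maximal_line 3 (X - M1) K1"
      "K2 \<in> {a, u, v}" "maximal_line 3 (X - M2) K2" "K3 \<in> {a, u, v}" "maximal_line 3 (X - M3) K3"
    using side[OF M Z_def[symmetric]] side[OF M(2,1,3) M'(1) M(6,5)] side[OF M(3,1,2) M'(2,3) M(4)] by blast
  have "K1 \<noteq> K2" "K1 \<noteq> K3" "K2 \<noteq> K3"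
    using two[OF K(1) M(1,2,4) neM(2)[OF K(1)]] two[OF K(1) M(1,3,5) neM(3)[OF K(1)]]
      two[OF K(3) M(2,3,6) neM(3)[OF K(3)]] K(2,4,6) by blast+
  then consider "K1 = a" "K2 = u" "K3 = v" | "K1 = a" "K2 = v" "K3 = u" | "K1 = u" "K2 = a" "K3 = v"
    | "K1 = u" "K2 = v" "K3 = a" | "K1 = v" "K2 = a" "K3 = u" | "K1 = v" "K2 = u" "K3 = a"
    using K(1,3,5) unfolding insert_iff empty_iff by metis
  then show False
  proof cases
    case 1 then show False using tri[of M1 M2 M3] M M' E4n RX RX' K by blast
  next
    case 2 then show False using tri[of M1 M3 M2] M M' E4n RX RX' K by blast
  next
    case 3 then show False using tri[of M2 M1 M3] M M' E4n RX RX' K by blast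
  next
    case 4 then show False using tri[of M3 M1 M2] M M' E4n RX RX' K by blast
  next
    case 5 then show False using tri[of M2 M3 M1] M M' E4n RX RX' K by blast
  next
    case 6 then show False using tri[of M3 M2 M1] M M' E4n RX RX' K by blast
  qed
qed

end

subsection \<open>All degrees\<close>

text \<open>\<open>X\<close> consists of the vertices of a triangle, and \<open>L\<close> contains
  one of them: two sides meet there and the third misses it. Both configurations are needed because
  both binomials are 0 for \<open>n = 1\<close>.\<close>

lemma missed_and_vertex_degree_1:
  assumes GM: "GM_conjecture 1" and GC: "GC_nat 1 X" and L: "node_line 1 X L"
  shows "\<exists>M. maximal_line 1 X M \<and> M \<inter> L \<inter> X = {}"
    and "\<exists>M M' P. maximal_line 1 X M \<and> maximal_line 1 X M' \<and> M \<noteq> M' \<and> P \<in> X \<and> M \<inter> M' = {P} \<and> P \<in> L"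
proof -
  have GM': "\<And>k. 1 \<le> k \<Longrightarrow> k \<le> 1 \<Longrightarrow> GM_conjecture k" using GM by (metis le_antisym)
  obtain M1 M2 M3 where M: "maximal_line 1 X M1" "maximal_line 1 X M2" "maximal_line 1 X M3"
      "M1 \<noteq> M2" "M1 \<noteq> M3" "M2 \<noteq> M3" 
    using three_maximal_lines[OF _ GM' GC] by auto
  obtain P Q R where P: "P \<in> X" "M1 \<inter> M2 = {P}" and Q: "Q \<in> X" "M1 \<inter> M3 = {Q}" and R: "R \<in> X" "M2 \<inter> M3 = {R}"
    using maximal_lines_meet[OF GC _ M(1,2,4)] maximal_lines_meet[OF GC _ M(1,3,5)]
      maximal_lines_meet[OF GC _ M(2,3,6)] by auto
  have mem: "P \<in> M1" "P \<in> M2" "Q \<in> M1" "Q \<in> M3" "R \<in> M2" "R \<in> M3" using P(2) Q(2) R(2) by blast+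
  have one: "1 \<le> (1::nat)" by simp
  have ne: "P \<notin> M3" "Q \<notin> M2" "R \<notin> M1"
    using maximal_lines_not_concurrent[OF GC one M(1-6) mem(1,2)]
      maximal_lines_not_concurrent[OF GC one M(1,3,2,5,4) M(6)[symmetric] mem(3,4)]
      maximal_lines_not_concurrent[OF GC one M(2,3,1,6) M(4,5)[symmetric] mem(5,6)] .
  then have neq: "P \<noteq> Q" "P \<noteq> R" "Q \<noteq> R" using mem by metis+
  have "card X = 3" using card_GC_nat[OF GM' GC] by (simp add: numeral_3_eq_3 numeral_2_eq_2)
  then have X: "X = {P, Q, R}"
    using card_subset_eq[of X "{P, Q, R}"] GC_nat_finite[OF GC] P(1) Q(1) R(1) neq by simp
  obtain A where A: "X \<inter> L = {A}" using L by (auto simp: node_line_def card_1_singleton_iff)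
  then have "A \<in> {P, Q, R}" using X by blast
  then obtain N N' N'' where N: "maximal_line 1 X N" "maximal_line 1 X N'" "maximal_line 1 X N''"
      "N \<noteq> N'" "N \<inter> N' = {A}" "A \<notin> N''"
    using M P(2) Q(2) R(2) ne by (elim insertE emptyE) metis+
  have "A \<in> X" "A \<in> L" using A by blast+
  then show "\<exists>M M' P. maximal_line 1 X M \<and> maximal_line 1 X M' \<and> M \<noteq> M' \<and> P \<in> X \<and> M \<inter> M' = {P} \<and> P \<in> L"
    using N by blast
  have "N'' \<inter> (X \<inter> L) = {}" unfolding A using N(6) by simp
  then have "N'' \<inter> L \<inter> X = {}" by blast
  then show "\<exists>M. maximal_line 1 X M \<and> M \<inter> L \<inter> X = {}" using N(3) by blast
qed

text \<open>Three maximal lines would meet \<open>L\<close> in three different nodes, one too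
  many.\<close>

lemma bad_degree_2:
  assumes GM: "\<And>k. 1 \<le> k \<Longrightarrow> k \<le> 2 \<Longrightarrow> GM_conjecture k"
    and GC: "GC_nat 2 X" and L: "node_line 2 X L" and bad: "\<not> missed_or_vertex 2 X L"
  shows False
proof -
  obtain M1 M2 M3 where M: "maximal_line 2 X M1" "maximal_line 2 X M2" "maximal_line 2 X M3"
      "M1 \<noteq> M2" "M1 \<noteq> M3" "M2 \<noteq> M3" 
    using three_maximal_lines[OF _ GM GC] by auto
  have ex: "\<exists>E. E \<in> X \<and> E \<in> L \<and> E \<in> M" if "maximal_line 2 X M" for M
    using maximal_meets_L[OF GC _ L bad that] by auto
  obtain E1 E2 E3 where E: "E1 \<in> X" "E1 \<in> L" "E1 \<in> M1" "E2 \<in> X" "E2 \<in> L" "E2 \<in> M2" "E3 \<in> X" "E3 \<in> L" "E3 \<in> M3"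
    using ex[OF M(1)] ex[OF M(2)] ex[OF M(3)] by blast
  have one: "1 \<le> (2::nat)" by simp
  have "E1 \<notin> M2" "E1 \<notin> M3" "E2 \<notin> M3"
    using maximal_lines_disjoint_on_L[OF GC one L bad M(1,2,4) E(2,3)]
      maximal_lines_disjoint_on_L[OF GC one L bad M(1,3,5) E(2,3)]
      maximal_lines_disjoint_on_L[OF GC one L bad M(2,3,6) E(5,6)] .
  then have "E1 \<noteq> E2" "E1 \<noteq> E3" "E2 \<noteq> E3" using E by blast+
  then have "3 = card {E1, E2, E3}" by simp
  also have "\<dots> \<le> card (X \<inter> L)" using E GC_nat_finite[OF GC] by (intro card_mono) auto
  finally show False using L by (simp add: node_line_def)
qed

text \<open>Only degrees at least 5 step down, to degrees at least 4. The excluded degree 3 is thus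
  never reached, and degree 4 is a base case.\<close>

lemma missed_or_vertex:
  assumes "1 \<le> n" "n \<noteq> 3" "\<And>k. 1 \<le> k \<Longrightarrow> k \<le> n \<Longrightarrow> GM_conjecture k"
    and "GC_nat n X" "node_line n X L"
  shows "missed_or_vertex n X L"
  using assms
proof (induction n arbitrary: X rule: less_induct)
  case (less n)
  show ?case
  proof (rule ccontr)
    assume bad: "\<not> missed_or_vertex n X L"
    consider "n = 1" | "n = 2" | "n = 4" | "5 \<le> n" using less.prems(1,2) by linarith
    then show False
    proof cases
      case 1
      then show False
        using missed_and_vertex_degree_1(1)[of X L] less.prems bad unfolding missed_or_vertex_def by auto
    next
      case 2
      then show False using bad_degree_2[of X L] less.prems bad by blast
    next
      case 3
      then show False using bad_degree_4[of X L] less.prems bad by blast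
    next
      case 4
      obtain M M' where M: "maximal_line n X M" "maximal_line n X M'" "M \<noteq> M'"
        using three_maximal_lines[OF less.prems(1,3,4)] by blast
      have step: "missed_or_vertex (n - 1) (X - N) L" if N: "maximal_line n X N" for N
        using less.IH[of "n - 1" "X - N"] 4 less.prems(3) GC_nat_Diff[OF less.prems(4,1) N]
          node_line_Diff[OF less.prems(4,1,5) bad N] by simp
      show False using bad_degree_ge_5[OF less.prems(4,1,5) bad 4 M step[OF M(1)] step[OF M(2)]] .
    qed
  qed
qed

section \<open>The users as a GC set and their number\<close>

lemma GC_set_Diff:
  assumes "GC_nat n X" "maximal_line n X M" shows "GC_set (int n - 1) (X - M)"
proof (cases n)
  case 0
  then obtain P where X: "X = {P}" using GC_nat_0D assms(1) by blast
  moreover have "P \<in> M" using assms(2) 0 unfolding X by (cases "P \<in> M") (auto simp: maximal_line_iff)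
  ultimately show ?thesis using 0 by (simp add: GC_set_def)
next
  case (Suc m)
  then show ?thesis using GC_nat_Diff_maximal[of m X M] assms by (simp add: GC_set_def)
qed

lemma card_GC_set:
  assumes "\<And>k. 1 \<le> k \<Longrightarrow> k \<le> n \<Longrightarrow> GM_conjecture k" "GC_set (int n - 2) Y"
  shows "card Y = n choose 2"
proof (cases "n < 2")
  case True
  then show ?thesis using assms(2) by (simp add: GC_set_def binomial_eq_0)
next
  case False
  then have n: "nat (int n - 2) = n - 2" "n - 2 + 2 = n" by linarith+
  have "GC_nat (n - 2) Y" using assms(2) False unfolding GC_set_def n(1) by simp
  moreover have "\<And>k. 1 \<le> k \<Longrightarrow> k \<le> n - 2 \<Longrightarrow> GM_conjecture k" using assms(1) by simp
  ultimately have "card Y = (n - 2 + 2) choose 2" using card_GC_nat[of "n - 2" Y] by blast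
  then show ?thesis using n(2) by simp
qed

lemma GC_set_line_missing_maximal:
  assumes GC: "GC_nat n X" "1 \<le> n" and L: "node_line n X L"
    and M: "maximal_line n X M" "M \<inter> L \<inter> X = {}"
  shows "GC_set (int n - 2) (X - (L \<union> M))"
proof -
  have "(X - M) \<inter> L = X \<inter> L" using M(2) by blast
  then have "maximal_line (n - 1) (X - M) L"
    \<comment> \<open>\<open>L\<close> keeps its \<open>n\<close> nodes, which is the maximal number
      in degree \<open>n - 1\<close>.\<close>
    using L GC(2) by (simp add: maximal_line_iff node_line_def)
  then have "GC_set (int (n - 1) - 1) (X - M - L)" using GC_set_Diff GC_nat_Diff GC M(1) by blast
  moreover have "X - M - L = X - (L \<union> M)" by blast
  ultimately show ?thesis using GC(2) by (simp add: of_nat_diff)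
qed

lemma GC_set_line_through_vertex:
  assumes GC: "GC_nat n X" "1 \<le> n" and L: "node_line n X L"
    and M: "maximal_line n X M" "maximal_line n X M'" "M \<noteq> M'" "M \<inter> M' = {P}" "P \<in> X" "P \<in> L"
  shows "GC_set (int n - 3) (X - (L \<union> M \<union> M'))"
proof -
  have GC1: "GC_nat (n - 1) (X - M)" using GC_nat_Diff GC M(1) .
  have max1: "maximal_line (n - 1) (X - M) M'" using maximal_line_Diff[OF GC M(1-3)] .
  have eq: "X - M - M' - L = X - (L \<union> M \<union> M')" by blast
  show ?thesis
  proof (cases "n = 1")
    \<comment> \<open>Here the set is already empty after the removal of \<open>M\<close> and
      \<open>M'\<close>, as the convention for degree -2 requires.\<close>
    case True
    then have "X - M - M' = {}" using GC_set_Diff[OF GC1 max1] by (simp add: GC_set_def)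
    then have "X - (L \<union> M \<union> M') = {}" by blast
    then show ?thesis using True by (simp add: GC_set_def)
  next
    case False
    then have n: "2 \<le> n" using GC(2) by simp
    have GC2: "GC_nat (n - 1 - 1) (X - M - M')" using GC_nat_Diff[OF GC1 _ max1] n by simp
    have "Q \<notin> M" "Q \<notin> M'" if "Q \<in> L" "Q \<noteq> P" for Q
    proof -
      have lines: "is_line L" "is_line M" "is_line M'" and ne: "L \<noteq> M" "L \<noteq> M'"
        using L M(1,2) by (auto simp: node_line_def maximal_line_iff)
      have "P \<in> M" "P \<in> M'" using M(4) by blast+
      then show "Q \<notin> M" "Q \<notin> M'"
        using line_eqI[OF lines(1,2) M(6) that(1)] line_eqI[OF lines(1,3) M(6) that(1)] ne that(2) by metis+
    qed
    moreover have "P \<in> M" using M(4) by blast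
    ultimately have "(X - M - M') \<inter> L = X \<inter> L - {P}" by blast
    then have "maximal_line (n - 1 - 1) (X - M - M') L"
      using L M(5,6) n by (simp add: maximal_line_iff node_line_def)
    then have "GC_set (int (n - 1 - 1) - 1) (X - M - M' - L)" using GC_set_Diff GC2 by blast
    then show ?thesis using n unfolding eq by (simp add: of_nat_diff)
  qed
qed

theorem theorem3p1:
  fixes n :: nat and X :: "point set" and L :: "point set"
  assumes "n \<ge> 1" and "n \<noteq> 3"
    and "\<And>k. 1 \<le> k \<Longrightarrow> k \<le> n \<Longrightarrow> GM_conjecture k"
    and "GC_set (int n) X"
    and "node_line n X L"
  shows "(card (users n X L) = n choose 2 \<or> card (users n X L) = (n - 1) choose 2)
    \<and> (card (users n X L) = n choose 2 \<longleftrightarrow>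
         (\<exists>M0. maximal_line n X M0 \<and> M0 \<inter> L \<inter> X = {}))
    \<and> (\<forall>M0. maximal_line n X M0 \<and> M0 \<inter> L \<inter> X = {} \<longrightarrow>
         users n X L = X - (L \<union> M0) \<and> GC_set (int n - 2) (users n X L))
    \<and> (card (users n X L) = (n - 1) choose 2 \<longleftrightarrow>
         (\<exists>M' M''. maximal_line n X M' \<and> maximal_line n X M'' \<and> M' \<noteq> M'' \<and>
            (\<exists>A\<in>X. M' \<inter> M'' = {A} \<and> A \<in> L)))
    \<and> (\<forall>M' M''. maximal_line n X M' \<and> maximal_line n X M'' \<and> M' \<noteq> M'' \<and>
            (\<exists>A\<in>X. M' \<inter> M'' = {A} \<and> A \<in> L) \<longrightarrow>
         users n X L = X - (L \<union> M' \<union> M'') \<and> GC_set (int n - 3) (users n X L))"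
proof -
  have GC: "GC_nat n X" using assms(4) by (simp add: GC_set_def)
  note L = assms(5)
  let ?U = "users n X L"
  let ?miss = "\<lambda>M. maximal_line n X M \<and> M \<inter> L \<inter> X = {}"
  let ?vertex = "\<lambda>M M'. maximal_line n X M \<and> maximal_line n X M' \<and> M \<noteq> M' \<and>
    (\<exists>A\<in>X. M \<inter> M' = {A} \<and> A \<in> L)"
  have miss: "?U = X - (L \<union> M) \<and> GC_set (int n - 2) ?U" if "?miss M" for M
    using users_of_line_missing_maximal[OF GC L] GC_set_line_missing_maximal[OF GC assms(1) L] that by metis
  have vertex: "?U = X - (L \<union> M \<union> M') \<and> GC_set (int n - 3) ?U" if "?vertex M M'" for M M'
  proof -
    obtain A where A: "maximal_line n X M" "maximal_line n X M'" "M \<noteq> M'" "M \<inter> M' = {A}" "A \<in> X" "A \<in> L"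
      using \<open>?vertex M M'\<close> by blast
    show ?thesis
      using users_of_line_through_vertex[OF GC L A] GC_set_line_through_vertex[OF GC assms(1) L A] by simp
  qed
  have card_miss: "card ?U = n choose 2" if "?miss M" for M
    using card_GC_set[of n ?U] assms(3) miss[OF that] by blast
  have card_vertex: "card ?U = (n - 1) choose 2" if "?vertex M M'" for M M'
  proof (rule card_GC_set)
    have "int (n - 1) - 2 = int n - 3" using assms(1) by linarith
    then show "GC_set (int (n - 1) - 2) ?U" using vertex[OF that] by metis
  qed (use assms(3) in simp)
  have either: "(\<exists>M. ?miss M) \<or> (\<exists>M M'. ?vertex M M')"
    using missed_or_vertex[OF assms(1-3) GC L] unfolding missed_or_vertex_def by blast
  \<comment> \<open>The two binomials agree only for \<open>n = 1\<close>, where both configurations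
    occur; otherwise the cardinality tells which configuration holds. This gives the converse
    directions.\<close>
  have both: "(\<exists>M. ?miss M) \<and> (\<exists>M M'. ?vertex M M')" if "n choose 2 = (n - 1) choose 2"
  proof -
    have "n = 1"
    proof (rule ccontr)
      assume "n \<noteq> 1"
      then obtain m where "n = Suc (Suc m)" using assms(1) by (metis One_nat_def Suc_le_D old.nat.exhaust)
      then show False using \<open>n choose 2 = (n - 1) choose 2\<close> by (simp add: numeral_2_eq_2)
    qed
    then show ?thesis
      using missed_and_vertex_degree_1[of X L] assms(3)[of 1] GC L by blast
  qed
  show ?thesis
    using miss vertex card_miss card_vertex either both by (intro conjI allI impI) metis+
qed

end
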